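(* Let $\mathcal G$ be the class of group languages and let $L$ belong to $\mathcal{SE}(\mathcal G)$, the closure of $\mathcal G$ under shuffle, iterated shuffle, union, concatenation and Kleene star. Then $\operatorname{perm}(L)$ is effectively regular, i.e. $\operatorname{perm}(L)$ is a regular language and a recognizing automaton for it is computable from an expression representing $L$ (built with the operations shuffle, iterated shuffle, union, concatenation and Kleene star from permutation automata for group languages).
   Context: All automata are finite, complete and deterministic. A permutation automaton is an automaton $(\Sigma,Q,\delta,q_0,F)$ such that for each letter $a \in \Sigma$ the map $q \mapsto \delta(q,a)$ is a bijection of $Q$. A language is a group language if it is recognized by some permutation automaton. The shuffle of words $u,v$, written $u\,ш\,v$, is the set of all words $x_1y_1x_2y_2\cdots x_ny_n$ with $x_i,y_i \in \Sigma^*$, $u = x_1\cdots x_n$, $v = y_1 \cdots y_n$; for languages, $L_1\,ш\,L_2 = \bigcup_{x \in L_1, y \in L_2} x\,ш\,y$. The iterated shuffle of $L$ is $L^{ш,*} = \bigcup_{n \ge 0} (L\,ш\cdots ш\,L)$ ($n$ copies, the case $n=0$ giving $\{\varepsilon\}$). The commutative closure of $L \subseteq \Sigma^*$ is $\operatorname{perm}(L) = \{u \in \Sigma^* \mid \exists w \in L: |u|_a = |w|_a \text{ for all } a \in \Sigma\}$, where $|w|_a$ is the number of occurrences of the letter $a$ in $w$. *)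

theory Defs
  imports Main "HOL-Library.Nat_Bijection"
begin

section \<open>Automata, regular languages and group languages\<close>

record ('a, 'q) automaton =
  alphabet :: "'a set"
  states :: "'q set"
  transition :: "'q \<Rightarrow> 'a \<Rightarrow> 'q"
  initial :: 'q
  final :: "'q set"

definition automaton :: "('a, 'q) automaton \<Rightarrow> bool" where
  "automaton A \<longleftrightarrow>
     finite (alphabet A) \<and> finite (states A) \<and>
     (\<forall>q\<in>states A. \<forall>a\<in>alphabet A. transition A q a \<in> states A) \<and>
     initial A \<in> states A \<and> final A \<subseteq> states A"

definition permutation_automaton :: "('a, 'q) automaton \<Rightarrow> bool" where
  "permutation_automaton A \<longleftrightarrow>
     automaton A \<and> (\<forall>a\<in>alphabet A. bij_betw (\<lambda>q. transition A q a) (states A) (states A))"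

definition language :: "('a, 'q) automaton \<Rightarrow> 'a list set" where
  "language A = {w \<in> lists (alphabet A). foldl (transition A) (initial A) w \<in> final A}"

text \<open>Taking the states to be natural numbers loses nothing: see \<open>standard_automaton_exists\<close>
  below, which renames the states of an automaton over an arbitrary state type.\<close>

definition regular_language :: "'a set \<Rightarrow> 'a list set \<Rightarrow> bool" where
  "regular_language \<Sigma> L \<longleftrightarrow>
     (\<exists>A :: ('a, nat) automaton. automaton A \<and> alphabet A = \<Sigma> \<and> language A = L)"

definition group_language :: "'a set \<Rightarrow> 'a list set \<Rightarrow> bool" where
  "group_language \<Sigma> L \<longleftrightarrow>
     (\<exists>A :: ('a, nat) automaton. permutation_automaton A \<and> alphabet A = \<Sigma> \<and> language A = L)"


section \<open>Operations on languages\<close>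

definition conc :: "'a list set \<Rightarrow> 'a list set \<Rightarrow> 'a list set" where
  "conc K L = {u @ v | u v. u \<in> K \<and> v \<in> L}"

definition star :: "'a list set \<Rightarrow> 'a list set" where
  "star L = {concat ws | ws. set ws \<subseteq> L}"

definition shuffle :: "'a list set \<Rightarrow> 'a list set \<Rightarrow> 'a list set" where
  "shuffle K L = (\<Union>u\<in>K. \<Union>v\<in>L. shuffles u v)"

text \<open>The library's \<^const>\<open>shuffles\<close> is the shuffle of words in terms of block factorisations.\<close>

lemma shuffles_iff_blocks:
  "w \<in> shuffles u v \<longleftrightarrow>
     (\<exists>xs ys. length xs = length ys \<and> u = concat xs \<and> v = concat ys \<and>
              w = concat (map2 (@) xs ys))"
proof
  show "\<exists>xs ys. length xs = length ys \<and> u = concat xs \<and> v = concat ys \<and>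
          w = concat (map2 (@) xs ys)" if "w \<in> shuffles u v"
    using that
  proof (induction u v arbitrary: w rule: shuffles.induct)
    case (1 ys)
    then show ?case by (intro exI[of _ "[[]]"] exI[of _ "[ys]"]) simp
  next
    case (2 xs)
    then show ?case by (intro exI[of _ "[xs]"] exI[of _ "[[]]"]) simp
  next
    case (3 x xs y ys)
    from "3.prems" consider
        w' where "w = x # w'" "w' \<in> shuffles xs (y # ys)"
      | w' where "w = y # w'" "w' \<in> shuffles (x # xs) ys"
      by auto
    then show ?case
    proof cases
      case 1
      then obtain as bs where "length as = length bs" "xs = concat as" "y # ys = concat bs"
          "w' = concat (map2 (@) as bs)"
        using "3.IH"(1) by blast
      with 1 show ?thesis by (intro exI[of _ "[x] # as"] exI[of _ "[] # bs"]) simp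
    next
      case 2
      then obtain as bs where "length as = length bs" "x # xs = concat as" "ys = concat bs"
          "w' = concat (map2 (@) as bs)"
        using "3.IH"(2) by blast
      with 2 show ?thesis by (intro exI[of _ "[] # as"] exI[of _ "[y] # bs"]) simp
    qed
  qed
next
  have prepend_left: "a @ w \<in> shuffles (a @ u) v" if "w \<in> shuffles u v" for a u v w :: "'a list"
    using that by (induction a) (auto intro: Cons_in_shuffles_leftI)
  have prepend_right: "b @ w \<in> shuffles u (b @ v)" if "w \<in> shuffles u v" for b u v w :: "'a list"
    using that by (induction b) (auto intro: Cons_in_shuffles_rightI)
  have "concat (map2 (@) xs ys) \<in> shuffles (concat xs) (concat ys)"
    if "length xs = length ys" for xs ys :: "'a list list"
    using that by (induction xs ys rule: list_induct2) (auto intro: prepend_left prepend_right)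
  then show "w \<in> shuffles u v"
    if "\<exists>xs ys. length xs = length ys \<and> u = concat xs \<and> v = concat ys \<and>
          w = concat (map2 (@) xs ys)"
    using that by blast
qed

primrec shuffle_power :: "nat \<Rightarrow> 'a list set \<Rightarrow> 'a list set" where
  "shuffle_power 0 L = {[]}"
| "shuffle_power (Suc n) L = shuffle L (shuffle_power n L)"

definition iterated_shuffle :: "'a list set \<Rightarrow> 'a list set" where
  "iterated_shuffle L = (\<Union>n. shuffle_power n L)"

definition perm_closure :: "'a set \<Rightarrow> 'a list set \<Rightarrow> 'a list set" where
  "perm_closure \<Sigma> L = {u \<in> lists \<Sigma>. \<exists>w\<in>L. \<forall>a\<in>\<Sigma>. count_list u a = count_list w a}"

inductive_set SE :: "'a list set set \<Rightarrow> 'a list set set" for \<G> :: "'a list set set" where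
  base: "L \<in> \<G> \<Longrightarrow> L \<in> SE \<G>"
| shuffle: "K \<in> SE \<G> \<Longrightarrow> L \<in> SE \<G> \<Longrightarrow> shuffle K L \<in> SE \<G>"
| iterated_shuffle: "L \<in> SE \<G> \<Longrightarrow> iterated_shuffle L \<in> SE \<G>"
| union: "K \<in> SE \<G> \<Longrightarrow> L \<in> SE \<G> \<Longrightarrow> K \<union> L \<in> SE \<G>"
| conc: "K \<in> SE \<G> \<Longrightarrow> L \<in> SE \<G> \<Longrightarrow> conc K L \<in> SE \<G>"
| star: "L \<in> SE \<G> \<Longrightarrow> star L \<in> SE \<G>"


section \<open>Computable functions\<close>

text \<open>The total recursive functions, as the least class containing the initial functions and
  closed under composition, primitive recursion and minimisation of regular functions (those for
  which a zero always exists).  Functions of several arguments are treated as unary ones by means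
  of the Cantor pairing function \<^const>\<open>prod_encode\<close>; the identity is the pairing of the two
  projections.\<close>

inductive computable :: "(nat \<Rightarrow> nat) \<Rightarrow> bool" where
  zero: "computable (\<lambda>_. 0)"
| succ: "computable Suc"
| left: "computable (\<lambda>x. fst (prod_decode x))"
| right: "computable (\<lambda>x. snd (prod_decode x))"
| pair: "computable f \<Longrightarrow> computable g \<Longrightarrow> computable (\<lambda>x. prod_encode (f x, g x))"
| comp: "computable f \<Longrightarrow> computable g \<Longrightarrow> computable (\<lambda>x. f (g x))"
| prec: "computable f \<Longrightarrow> computable g \<Longrightarrow>
    computable (\<lambda>x. rec_nat (f (fst (prod_decode x)))
      (\<lambda>m r. g (prod_encode (fst (prod_decode x), prod_encode (m, r)))) (snd (prod_decode x)))"
| mini: "computable f \<Longrightarrow> (\<And>x. \<exists>n. f (prod_encode (x, n)) = 0) \<Longrightarrow>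
    computable (\<lambda>x. LEAST n. f (prod_encode (x, n)) = 0)"


section \<open>Finite descriptions of automata and expressions\<close>

text \<open>An automaton handed to, or returned by, an algorithm has states \<open>0, \<dots>, n - 1\<close>, and its
  letters are numbered by their position in a list enumerating the alphabet.\<close>

definition standard_states :: "('a, nat) automaton \<Rightarrow> bool" where
  "standard_states A \<longleftrightarrow> states A = {..<card (states A)}"

text \<open>The code lists the numbers of letters and of states, the initial state, the
  characteristic sequence of the final states, and the transition table row by row.\<close>

definition automaton_code :: "'a list \<Rightarrow> ('a, nat) automaton \<Rightarrow> nat" where
  "automaton_code letters A = list_encode
     [length letters,
      card (states A),
      initial A,
      list_encode (map (\<lambda>q. of_bool (q \<in> final A)) [0..<card (states A)]),
      list_encode (map (\<lambda>q. list_encode (map (transition A q) letters)) [0..<card (states A)])]"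

datatype 'a expr =
    EAut "('a, nat) automaton"
  | EShuffle "'a expr" "'a expr"
  | EIterated_Shuffle "'a expr"
  | EUnion "'a expr" "'a expr"
  | EConc "'a expr" "'a expr"
  | EStar "'a expr"

primrec expr_over :: "'a set \<Rightarrow> 'a expr \<Rightarrow> bool" where
  "expr_over \<Sigma> (EAut A) \<longleftrightarrow> permutation_automaton A \<and> standard_states A \<and> alphabet A = \<Sigma>"
| "expr_over \<Sigma> (EShuffle d e) \<longleftrightarrow> expr_over \<Sigma> d \<and> expr_over \<Sigma> e"
| "expr_over \<Sigma> (EIterated_Shuffle e) \<longleftrightarrow> expr_over \<Sigma> e"
| "expr_over \<Sigma> (EUnion d e) \<longleftrightarrow> expr_over \<Sigma> d \<and> expr_over \<Sigma> e"
| "expr_over \<Sigma> (EConc d e) \<longleftrightarrow> expr_over \<Sigma> d \<and> expr_over \<Sigma> e"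
| "expr_over \<Sigma> (EStar e) \<longleftrightarrow> expr_over \<Sigma> e"

primrec expr_language :: "'a expr \<Rightarrow> 'a list set" where
  "expr_language (EAut A) = language A"
| "expr_language (EShuffle d e) = shuffle (expr_language d) (expr_language e)"
| "expr_language (EIterated_Shuffle e) = iterated_shuffle (expr_language e)"
| "expr_language (EUnion d e) = expr_language d \<union> expr_language e"
| "expr_language (EConc d e) = conc (expr_language d) (expr_language e)"
| "expr_language (EStar e) = star (expr_language e)"

primrec expr_code :: "'a list \<Rightarrow> 'a expr \<Rightarrow> nat" where
  "expr_code letters (EAut A) = prod_encode (0, automaton_code letters A)"
| "expr_code letters (EShuffle d e) =
     prod_encode (1, prod_encode (expr_code letters d, expr_code letters e))"
| "expr_code letters (EIterated_Shuffle e) = prod_encode (2, expr_code letters e)"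
| "expr_code letters (EUnion d e) =
     prod_encode (3, prod_encode (expr_code letters d, expr_code letters e))"
| "expr_code letters (EConc d e) =
     prod_encode (4, prod_encode (expr_code letters d, expr_code letters e))"
| "expr_code letters (EStar e) = prod_encode (5, expr_code letters e)"


section \<open>Adequacy of the normal form of automata and of the expressions\<close>

lemma standard_automaton_exists:
  fixes A :: "('a, 'q) automaton"
  assumes A: "automaton A"
  obtains B :: "('a, nat) automaton" where
    "automaton B" "standard_states B" "alphabet B = alphabet A" "language B = language A"
    "permutation_automaton A \<Longrightarrow> permutation_automaton B"
proof -
  let ?Q = "states A" and ?n = "card (states A)"
  have fin: "finite ?Q" using A by (simp add: automaton_def)
  then obtain h where h: "bij_betw h ?Q {..<?n}"
    using ex_bij_betw_finite_nat[of ?Q] by (auto simp: atLeast0LessThan)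
  define g where "g = inv_into ?Q h"
  have g: "bij_betw g {..<?n} ?Q" unfolding g_def using h by (rule bij_betw_inv_into)
  have gh: "g (h q) = q" if "q \<in> ?Q" for q
    using that h by (simp add: g_def bij_betw_inv_into_left)
  have hQ: "h q \<in> {..<?n}" if "q \<in> ?Q" for q using that h bij_betwE by metis
  have gQ: "g p \<in> ?Q" if "p \<in> {..<?n}" for p using that g bij_betwE by metis
  define B where "B = \<lparr>alphabet = alphabet A, states = {..<?n}, transition = (\<lambda>p a. h (transition A (g p) a)),
    initial = h (initial A), final = h ` final A\<rparr>"
  have B: "automaton B" using A hQ gQ unfolding automaton_def B_def by auto
  have run: "foldl (transition B) (h q) w = h (foldl (transition A) q w) \<and> foldl (transition A) q w \<in> ?Q"
    if "q \<in> ?Q" "w \<in> lists (alphabet A)" for q w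
    using that(2,1)
  proof (induction w arbitrary: q rule: lists.induct)
    case Nil
    then show ?case by simp
  next
    case (Cons a w)
    then have "transition A q a \<in> ?Q" using A by (simp add: automaton_def)
    moreover have "transition B (h q) a = h (transition A q a)" using Cons.prems by (simp add: B_def gh)
    ultimately show ?case using Cons.IH by simp
  qed
  have final: "h q \<in> h ` final A \<longleftrightarrow> q \<in> final A" if "q \<in> ?Q" for q
    using that A gh unfolding automaton_def by (metis image_iff subsetD)
  have lang: "language B = language A"
  proof -
    have "foldl (transition B) (initial B) w \<in> final B \<longleftrightarrow> foldl (transition A) (initial A) w \<in> final A"
      if "w \<in> lists (alphabet A)" for w
      using run[OF _ that, of "initial A"] final A by (simp add: automaton_def B_def)
    then show ?thesis unfolding language_def by (auto simp: B_def)
  qed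
  have "permutation_automaton B" if "permutation_automaton A"
  proof -
    have "bij_betw (\<lambda>p. transition B p a) (states B) (states B)" if "a \<in> alphabet A" for a
    proof -
      have "bij_betw (\<lambda>q. transition A q a) ?Q ?Q"
        using \<open>permutation_automaton A\<close> that by (simp add: permutation_automaton_def)
      from bij_betw_trans[OF bij_betw_trans[OF g this] h]
      show ?thesis by (simp add: B_def comp_def)
    qed
    then show ?thesis using B by (simp add: permutation_automaton_def B_def)
  qed
  with B lang that show thesis by (simp add: standard_states_def B_def)
qed

lemma SE_iff_expr:
  "L \<in> SE {K. group_language \<Sigma> K} \<longleftrightarrow> (\<exists>e. expr_over \<Sigma> e \<and> expr_language e = L)"
proof
  show "\<exists>e. expr_over \<Sigma> e \<and> expr_language e = L" if "L \<in> SE {K. group_language \<Sigma> K}"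
    using that
  proof induction
    case (base L)
    then obtain A :: "('a, nat) automaton" where
      A: "permutation_automaton A" "alphabet A = \<Sigma>" "language A = L"
      by (auto simp: group_language_def)
    then have "automaton A" by (simp add: permutation_automaton_def)
    from standard_automaton_exists[OF this] A obtain B :: "('a, nat) automaton" where
      "standard_states B" "alphabet B = \<Sigma>" "language B = L" "permutation_automaton B"
      by metis
    then show ?case by (intro exI[of _ "EAut B"]) simp
  next
    case (shuffle K L)
    then show ?case by (metis expr_over.simps(2) expr_language.simps(2))
  next
    case (iterated_shuffle L)
    then show ?case by (metis expr_over.simps(3) expr_language.simps(3))
  next
    case (union K L)
    then show ?case by (metis expr_over.simps(4) expr_language.simps(4))
  next
    case (conc K L)
    then show ?case by (metis expr_over.simps(5) expr_language.simps(5))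
  next
    case (star L)
    then show ?case by (metis expr_over.simps(6) expr_language.simps(6))
  qed
next
  have "expr_over \<Sigma> e \<Longrightarrow> expr_language e \<in> SE {K. group_language \<Sigma> K}" for e
  proof (induction e)
    case (EAut A)
    then have "group_language \<Sigma> (language A)" by (auto simp: group_language_def)
    then show ?case by (auto intro: SE.base)
  qed (auto intro: SE.intros)
  then show "L \<in> SE {K. group_language \<Sigma> K}" if "\<exists>e. expr_over \<Sigma> e \<and> expr_language e = L"
    using that by blast
qed

end

theory Submission
  imports Defs "HOL-Library.Multiset" "HOL-Library.FuncSet"
begin

text \<open>Take words to their multisets of letters: shuffle and concatenation both become addition of sets
  of multisets, iterated shuffle and Kleene star both become the generated submonoid. If \<open>n\<close> is a
  common multiple of the orders of all letters in all automata of an expression, then inserting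
  \<open>a\<^sup>n\<close> does not change membership in the group languages, and the set of multisets \<open>S\<close> of the whole
  expression satisfies \<open>S - {0} + n \<nat>\<^sup>k \<subseteq> S\<close>. Pigeonhole arguments bound the size of the generators of
  \<open>S\<close> with respect to adding multiples of \<open>n\<close>, so an automaton counting each letter exactly up to a
  computable threshold and modulo \<open>n\<close> beyond it recognises the commutative closure. Its final states
  are found by deciding membership of small vectors in \<open>S\<close>, by recursion over the expression; vectors
  are coded additively as single numbers, so that sums of vectors are sums of numbers.\<close>

section \<open>Closure properties of computable functions\<close>

text \<open>Regularity of \<open>L\<close> alone would not do: for the star of the word
  \<open>ab\<close> the commutative closure consists of the words with as many \<open>a\<close> as
  \<open>b\<close>. In a group language such a balance cannot be enforced, because \<open>n\<close>
  copies of one letter can be inserted independently of the others.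

  All constants are functions of the number \<open>k\<close> of letters and the code
  \<open>x\<close> of the whole expression. The code is at least the number of states of every
  automaton inside, so \<open>fact x\<close> is a period for all of them at once. It also exceeds
  the codes of all proper subexpressions and so replaces a depth measure: an operation costs at most
  one factor \<open>gap_bound k x\<close> in the size of the generators, and the successor of the
  code serves as exponent.

  The generators themselves are never computed. For a given weight the membership test is a finite
  search, since a nontrivial decomposition leaves a smaller expression or a smaller weight.\<close>

named_theorems computable_intros

abbreviation decidable :: "(nat \<Rightarrow> bool) \<Rightarrow> bool" where
  "decidable P \<equiv> computable (\<lambda>x. of_bool (P x))"

abbreviation pfst :: "nat \<Rightarrow> nat" where "pfst z \<equiv> fst (prod_decode z)"
abbreviation psnd :: "nat \<Rightarrow> nat" where "psnd z \<equiv> snd (prod_decode z)"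

lemma computable_id [computable_intros]: "computable (\<lambda>x. x)"
  using computable.pair[OF computable.left computable.right] by simp

lemma computable_Suc [computable_intros]: "computable f \<Longrightarrow> computable (\<lambda>x. Suc (f x))"
  by (rule computable.comp[OF computable.succ])

lemma computable_const [computable_intros]: "computable (\<lambda>_. c)"
  by (induction c) (auto intro: computable.zero computable_Suc)

lemma computable_pfst [computable_intros]: "computable f \<Longrightarrow> computable (\<lambda>x. pfst (f x))"
  by (rule computable.comp[OF computable.left])

lemma computable_psnd [computable_intros]: "computable f \<Longrightarrow> computable (\<lambda>x. psnd (f x))"
  by (rule computable.comp[OF computable.right])

declare computable.pair [computable_intros]

text \<open>A bound variable is treated as the second component of a pair whose first component is the
  surrounding argument.\<close>

lemma computable_rec_nat [computable_intros]:
  assumes f: "computable f" and b: "computable b"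
    and g: "computable (\<lambda>z. g (pfst z) (pfst (psnd z)) (psnd (psnd z)))"
  shows "computable (\<lambda>x. rec_nat (f x) (g x) (b x))"
  using computable.comp[OF computable.prec[OF f g] computable.pair[OF computable_id b]] by simp

lemma computable_Least [computable_intros]:
  assumes P: "decidable (\<lambda>z. P (pfst z) (psnd z))" and ex: "\<And>x. \<exists>n. P x n"
  shows "computable (\<lambda>x. LEAST n. P x n)"
proof -
  \<comment> \<open>\<open>rec_nat 1 (\<lambda>_ _. 0)\<close> negates a truth value: it is 1 at 0
    and 0 at every successor. The negation is there because \<open>mini\<close> searches for a
    zero.\<close>
  have "computable (\<lambda>x. rec_nat 1 (\<lambda>_ _. 0) (of_bool (P (pfst x) (psnd x))))"
    by (intro computable_intros P)
  also have "(\<lambda>x. rec_nat 1 (\<lambda>_ _. 0) (of_bool (P (pfst x) (psnd x)))) = (\<lambda>x. of_bool (\<not> P (pfst x) (psnd x)) :: nat)"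
    by auto
  finally have "computable (\<lambda>x. of_bool (\<not> P (pfst x) (psnd x)))" .
  from computable.mini[OF this] ex show ?thesis by simp
qed

lemma computable_add [computable_intros]:
  assumes "computable f" "computable g"
  shows "computable (\<lambda>x. f x + g x)"
proof -
  have c: "computable (\<lambda>x. rec_nat (f x) (\<lambda>_ r. Suc r) (g x))"
    by (intro computable_intros assms)
  have eq: "rec_nat a (\<lambda>_ r. Suc r) b = a + b" for a b :: nat by (induction b) auto
  show ?thesis using c by (simp only: eq)
qed

lemma computable_mult [computable_intros]:
  assumes "computable f" "computable g"
  shows "computable (\<lambda>x. f x * g x)"
proof -
  have c: "computable (\<lambda>x. rec_nat 0 (\<lambda>_ r. f x + r) (g x))"
    by (intro computable_intros assms computable.comp[OF assms(1)])
  have eq: "rec_nat 0 (\<lambda>_ r. a + r) b = a * b" for a b :: nat by (induction b) auto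
  show ?thesis using c by (simp only: eq)
qed

lemma computable_power [computable_intros]:
  assumes "computable f" "computable g"
  shows "computable (\<lambda>x. f x ^ g x)"
proof -
  have c: "computable (\<lambda>x. rec_nat 1 (\<lambda>_ r. f x * r) (g x))"
    by (intro computable_intros assms computable.comp[OF assms(1)])
  have eq: "rec_nat 1 (\<lambda>_ r. a * r) b = a ^ b" for a b :: nat by (induction b) auto
  show ?thesis using c by (simp only: eq)
qed

lemma computable_fact [computable_intros]:
  assumes "computable f"
  shows "computable (\<lambda>x. fact (f x))"
proof -
  have c: "computable (\<lambda>x. rec_nat 1 (\<lambda>m r. Suc m * r) (f x))"
    by (intro computable_intros assms)
  have eq: "rec_nat 1 (\<lambda>m r. Suc m * r) b = fact b" for b :: nat by (induction b) auto
  show ?thesis using c by (simp only: eq)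
qed

lemma computable_diff [computable_intros]:
  assumes "computable f" "computable g"
  shows "computable (\<lambda>x. f x - g x)"
proof -
  have c: "computable (\<lambda>x. rec_nat (f x) (\<lambda>_ r. rec_nat 0 (\<lambda>m _. m) r) (g x))"
    by (intro computable_intros assms)
  have pred: "rec_nat 0 (\<lambda>m _. m) r = r - 1" for r :: nat by (cases r) auto
  then have eq: "rec_nat a (\<lambda>_ r. rec_nat 0 (\<lambda>m _. m) r) b = a - b" for a b :: nat
    by (induction b) auto
  show ?thesis using c by (simp only: eq)
qed

lemma decidable_not [computable_intros]:
  assumes "decidable P"
  shows "decidable (\<lambda>x. \<not> P x)"
proof -
  have c: "computable (\<lambda>x. 1 - of_bool (P x))" by (intro computable_intros assms)
  have eq: "1 - of_bool p = (of_bool (\<not> p) :: nat)" for p by simp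
  show ?thesis using c by (simp only: eq)
qed

lemma decidable_conj [computable_intros]:
  "decidable P \<Longrightarrow> decidable Q \<Longrightarrow> decidable (\<lambda>x. P x \<and> Q x)"
  using computable_mult[of "\<lambda>x. of_bool (P x)" "\<lambda>x. of_bool (Q x)"] by (simp add: of_bool_conj)

lemma decidable_disj [computable_intros]:
  assumes "decidable P" "decidable Q"
  shows "decidable (\<lambda>x. P x \<or> Q x)"
proof -
  have "decidable (\<lambda>x. \<not> (\<not> P x \<and> \<not> Q x))" by (intro computable_intros assms)
  then show ?thesis by simp
qed

lemma decidable_le [computable_intros]:
  assumes "computable f" "computable g"
  shows "decidable (\<lambda>x. f x \<le> g x)"
proof -
  have c: "computable (\<lambda>x. 1 - (f x - g x))" by (intro computable_intros assms)
  have eq: "1 - (a - b) = of_bool (a \<le> b)" for a b :: nat by simp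
  show ?thesis using c by (simp only: eq)
qed

lemma decidable_less [computable_intros]:
  "computable f \<Longrightarrow> computable g \<Longrightarrow> decidable (\<lambda>x. f x < g x)"
  using decidable_le[of "\<lambda>x. Suc (f x)" g] by (simp add: Suc_le_eq computable_Suc)

lemma decidable_eq [computable_intros]:
  assumes "computable f" "computable g"
  shows "decidable (\<lambda>x. f x = g x)"
proof -
  have "decidable (\<lambda>x. f x \<le> g x \<and> g x \<le> f x)" by (intro computable_intros assms)
  then show ?thesis by (simp add: eq_iff)
qed

lemma computable_if [computable_intros]:
  assumes "decidable P" "computable f" "computable g"
  shows "computable (\<lambda>x. if P x then f x else g x)"
proof -
  have "computable (\<lambda>x. of_bool (P x) * f x + of_bool (\<not> P x) * g x)"
    by (intro computable_intros assms)
  also have "(\<lambda>x. of_bool (P x) * f x + of_bool (\<not> P x) * g x) = (\<lambda>x. if P x then f x else g x)"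
    by auto
  finally show ?thesis .
qed

lemma decidable_if [computable_intros]:
  assumes "decidable P" "decidable Q" "decidable R"
  shows "decidable (\<lambda>x. if P x then Q x else R x)"
  using computable_if[OF assms] by (simp add: if_distrib)

lemma decidable_bex [computable_intros]:
  assumes "computable b" "decidable (\<lambda>z. P (pfst z) (psnd z))"
  shows "decidable (\<lambda>x. \<exists>i<b x. P x i)"
proof -
  have c: "computable (\<lambda>x. rec_nat 0 (\<lambda>m r. of_bool (r = 1 \<or> P x m)) (b x))"
    by (intro computable_intros assms computable.comp[OF assms(2), of "\<lambda>z. prod_encode (pfst z, pfst (psnd z))", simplified])
  have eq: "rec_nat 0 (\<lambda>m r. of_bool (r = 1 \<or> Q m)) c = of_bool (\<exists>i<c. Q i)" for Q and c :: nat
    by (induction c) (auto simp: less_Suc_eq)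
  show ?thesis using c by (simp only: eq)
qed

lemma computable_div [computable_intros]:
  assumes "computable f" "computable g"
  shows "computable (\<lambda>x. f x div g x)"
proof -
  \<comment> \<open>The disjunct \<open>g x = 0\<close> keeps the search total and gives 0, the
    value of division by zero.\<close>
  have "\<exists>n. g x = 0 \<or> f x < Suc n * g x" for x
    by (intro exI[of _ "f x"]) (cases "g x", auto)
  then have c: "computable (\<lambda>x. LEAST n. g x = 0 \<or> f x < Suc n * g x)"
    by (intro computable_intros assms computable.comp[OF assms(1)] computable.comp[OF assms(2)])
  have eq: "(LEAST n. b = 0 \<or> a < Suc n * b) = a div b" for a b :: nat
  proof (cases "b = 0")
    case False
    show ?thesis
    proof (rule Least_equality)
      show "b = 0 \<or> a < Suc (a div b) * b" using False by (simp add: dividend_less_div_times)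
    next
      fix n assume "b = 0 \<or> a < Suc n * b"
      then show "a div b \<le> n" using False by (metis less_Suc_eq_le less_mult_imp_div_less)
    qed
  qed auto
  show ?thesis using c by (simp only: eq)
qed

lemma computable_mod [computable_intros]:
  assumes "computable f" "computable g"
  shows "computable (\<lambda>x. f x mod g x)"
  unfolding minus_div_mult_eq_mod[symmetric] by (intro computable_intros assms)

section \<open>Numbers as codes of finite sets and lists\<close>

lemma decidable_set_decode [computable_intros]:
  assumes "computable f" "computable g"
  shows "decidable (\<lambda>x. f x \<in> set_decode (g x))"
  unfolding set_decode_def mem_Collect_eq odd_iff_mod_2_eq_one by (intro computable_intros assms)

text \<open>\<open>list_encode\<close> codes a nonempty list as the successor of the pair of its
  head and the code of its tail, so each projection is preceded by \<open>- 1\<close>.\<close>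

definition code_nth :: "nat \<Rightarrow> nat \<Rightarrow> nat" where
  "code_nth c i = pfst (rec_nat c (\<lambda>_ r. psnd (r - 1)) i - 1)"

lemma code_nth_list_encode:
  assumes "i < length xs"
  shows "code_nth (list_encode xs) i = xs ! i"
proof -
  have "rec_nat (list_encode xs) (\<lambda>_ r. psnd (r - 1)) i = list_encode (drop i xs)" if "i \<le> length xs" for i
    using that by (induction i) (auto simp flip: Cons_nth_drop_Suc)
  with assms show ?thesis by (simp add: code_nth_def flip: Cons_nth_drop_Suc)
qed

lemma computable_code_nth [computable_intros]:
  assumes "computable f" "computable g"
  shows "computable (\<lambda>x. code_nth (f x) (g x))"
  unfolding code_nth_def by (intro computable_intros assms)

lemma computable_list_encode_map_upt [computable_intros]:
  assumes b: "computable b" and g: "computable (\<lambda>z. g (pfst z) (psnd z))"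
  shows "computable (\<lambda>x. list_encode (map (g x) [0..<b x]))"
proof -
  \<comment> \<open>The head is the outermost part of a list code, so the recursion starts with the
    last entry: stage \<open>m\<close> holds the entries from position \<open>b x - m\<close>
    on.\<close>
  have c: "computable (\<lambda>x. rec_nat 0 (\<lambda>m r. Suc (prod_encode (g x (b x - Suc m), r))) (b x))"
    by (intro computable_intros b computable.comp[OF b]
        computable.comp[OF g, of "\<lambda>z. prod_encode (pfst z, b (pfst z) - Suc (pfst (psnd z)))", simplified])
  have "rec_nat 0 (\<lambda>m r. Suc (prod_encode (h (c - Suc m), r))) m = list_encode (map h [c - m..<c])"
    if "m \<le> c" for h :: "nat \<Rightarrow> nat" and c m
    using that
  proof (induction m)
    case (Suc m)
    then have "[c - Suc m..<c] = (c - Suc m) # [c - m..<c]"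
      by (metis Suc_diff_Suc Suc_le_lessD upt_conv_Cons zero_less_Suc diff_less less_le_trans)
    with Suc show ?case by simp
  qed simp
  then have eq: "rec_nat 0 (\<lambda>m r. Suc (prod_encode (h (c - Suc m), r))) c = list_encode (map h [0..<c])"
    for h :: "nat \<Rightarrow> nat" and c by fastforce
  show ?thesis using c by (simp only: eq)
qed

section \<open>Course-of-values recursion for predicates\<close>

definition history :: "(nat \<Rightarrow> nat \<Rightarrow> nat \<Rightarrow> bool) \<Rightarrow> nat \<Rightarrow> nat \<Rightarrow> nat" where
  "history C p i = rec_nat 0 (\<lambda>m r. of_bool (C p m r) * 2 ^ m + r) i"

text \<open>Course-of-values recursion: \<^term>\<open>C p i h\<close> decides the value at \<^term>\<open>i\<close> from the code
  \<^term>\<open>h\<close> of the set of all smaller arguments with value true.\<close>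

definition course_rec :: "(nat \<Rightarrow> nat \<Rightarrow> nat \<Rightarrow> bool) \<Rightarrow> nat \<Rightarrow> nat \<Rightarrow> bool" where
  "course_rec C p i = C p i (history C p i)"

lemma set_decode_history: "set_decode (history C p i) = {j. j < i \<and> course_rec C p j}"
proof (induction i)
  case 0
  then show ?case by (simp add: history_def)
next
  case (Suc i)
  have "history C p (Suc i) = of_bool (course_rec C p i) * 2 ^ i + history C p i"
    by (simp add: history_def course_rec_def)
  moreover have "i \<notin> set_decode (history C p i)" using Suc by simp
  ultimately show ?case using Suc by (auto simp: set_decode_plus_power_2 less_Suc_eq)
qed

lemma decidable_course_rec:
  assumes C: "decidable (\<lambda>z. C (pfst z) (pfst (psnd z)) (psnd (psnd z)))"
    and f: "computable f" and g: "computable g"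
  shows "decidable (\<lambda>x. course_rec C (f x) (g x))"
proof -
  have C': "decidable (\<lambda>x. C (u x) (v x) (w x))"
    if "computable u" "computable v" "computable w" for u v w
    using computable.comp[OF C, of "\<lambda>x. prod_encode (u x, prod_encode (v x, w x))"] that
    by (simp add: computable.pair)
  show ?thesis unfolding course_rec_def history_def
    by (intro C' computable_intros f g computable.comp[OF f])
qed


section \<open>Sets of multisets closed under multiples of a number\<close>

lemma repeat_mset_if_dvd_count:
  fixes X :: "'a multiset"
  assumes "\<And>a. n dvd count X a"
  obtains Z where "X = repeat_mset n Z" "set_mset Z \<subseteq> set_mset X"
proof -
  define Z where "Z = (\<Sum>a\<in>set_mset X. replicate_mset (count X a div n) a)"
  have count: "count Z a = count X a div n" for a
  proof -
    have "count Z a = (\<Sum>b\<in>set_mset X. if a = b then count X a div n else 0)"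
      by (auto simp: Z_def count_sum intro!: sum.cong)
    then show ?thesis by (simp add: not_in_iff)
  qed
  have "X = repeat_mset n Z"
    using assms by (intro multiset_eqI) (simp add: count)
  moreover have "set_mset Z \<subseteq> set_mset X"
    by (metis count count_greater_zero_iff div_0 gr0I subsetI zero_less_iff_neq_zero)
  ultimately show thesis using that by blast
qed

text \<open>Pigeonhole for \<open>m + 1\<close> indices against the
  \<open>card Q * n ^ card \<Sigma>\<close> pairs of a state and a vector of residues. Runs of
  automata use it with their states, partial sums of lists with a one-element
  \<open>Q\<close>.\<close>

lemma repeated_state_and_residues:
  fixes f :: "nat \<Rightarrow> 'a multiset" and st :: "nat \<Rightarrow> 'q"
  assumes "finite \<Sigma>" "0 < n" "finite Q"
    and st: "\<And>i. i \<le> m \<Longrightarrow> st i \<in> Q"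
    and m: "card Q * n ^ card \<Sigma> \<le> m"
  obtains i j where "i < j" "j \<le> m" "st i = st j"
    "\<And>a. a \<in> \<Sigma> \<Longrightarrow> count (f i) a mod n = count (f j) a mod n"
proof -
  define g where "g i = (st i, restrict (\<lambda>a. count (f i) a mod n) \<Sigma>)" for i
  have "g ` {..m} \<subseteq> Q \<times> (\<Sigma> \<rightarrow>\<^sub>E {..<n})"
    using st \<open>0 < n\<close> by (auto simp: g_def)
  then have "card (g ` {..m}) \<le> card (Q \<times> (\<Sigma> \<rightarrow>\<^sub>E {..<n}))"
    using assms by (intro card_mono) (auto intro: finite_PiE)
  also have "\<dots> = card Q * n ^ card \<Sigma>"
    using assms by (simp add: card_cartesian_product card_PiE)
  also have "\<dots> < card {..m}" using m by simp
  finally have "\<not> inj_on g {..m}" by (rule pigeonhole)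
  then obtain i j where ij: "i \<le> m" "j \<le> m" "i < j" "g i = g j"
    unfolding inj_on_def by (metis atMost_iff linorder_neqE_nat)
  then have "st i = st j" by (simp add: g_def)
  moreover have "count (f i) a mod n = count (f j) a mod n" if "a \<in> \<Sigma>" for a
    using fun_cong[OF arg_cong[OF ij(4), of snd], of a] that by (simp add: g_def)
  ultimately show thesis using that ij by blast
qed

text \<open>The empty multiset is exempt from the closure condition since the Kleene star adds it. By Dickson's
  lemma a bound \<open>b\<close> always exists; it is part of the definition so that it can be computed.\<close>

definition periodic :: "'a set \<Rightarrow> nat \<Rightarrow> nat \<Rightarrow> 'a multiset set \<Rightarrow> bool" where
  "periodic \<Sigma> n b S \<longleftrightarrow>
     (\<forall>X\<in>S. set_mset X \<subseteq> \<Sigma>) \<and>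
     (\<forall>X\<in>S. \<forall>Z. X \<noteq> {#} \<longrightarrow> set_mset Z \<subseteq> \<Sigma> \<longrightarrow> X + repeat_mset n Z \<in> S) \<and>
     (\<forall>X\<in>S. \<exists>Y\<in>S. \<exists>Z. set_mset Z \<subseteq> \<Sigma> \<and> X = Y + repeat_mset n Z \<and> size Y \<le> b \<and> (X \<noteq> {#} \<longrightarrow> Y \<noteq> {#}))"

lemma periodicI:
  assumes "\<And>X. X \<in> S \<Longrightarrow> set_mset X \<subseteq> \<Sigma>"
    and "\<And>X Z. X \<in> S \<Longrightarrow> X \<noteq> {#} \<Longrightarrow> set_mset Z \<subseteq> \<Sigma> \<Longrightarrow> X + repeat_mset n Z \<in> S"
    and "\<And>X. X \<in> S \<Longrightarrow> \<exists>Y\<in>S. \<exists>Z. set_mset Z \<subseteq> \<Sigma> \<and> X = Y + repeat_mset n Z \<and> size Y \<le> b \<and> (X \<noteq> {#} \<longrightarrow> Y \<noteq> {#})"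
  shows "periodic \<Sigma> n b S"
  using assms by (auto simp: periodic_def)

lemma periodicD:
  assumes "periodic \<Sigma> n b S" "X \<in> S"
  shows periodic_alphabet: "set_mset X \<subseteq> \<Sigma>"
    and periodic_add: "X \<noteq> {#} \<Longrightarrow> set_mset Z \<subseteq> \<Sigma> \<Longrightarrow> X + repeat_mset n Z \<in> S"
    and periodic_reduce: "\<exists>Y\<in>S. \<exists>Z. set_mset Z \<subseteq> \<Sigma> \<and> X = Y + repeat_mset n Z \<and> size Y \<le> b \<and> (X \<noteq> {#} \<longrightarrow> Y \<noteq> {#})"
  using assms by (auto simp: periodic_def)

text \<open>This allows counting modulo \<open>n\<close> above \<open>b\<close>. A generator of
  \<open>X + replicate_mset n a\<close> has at most \<open>b\<close> letters, hence fewer copies of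
  \<open>a\<close> than \<open>X\<close>; the multiple added to it therefore contains
  \<open>a\<close>, and one block of \<open>n\<close> copies can be taken back.\<close>

lemma periodic_wrap:
  assumes S: "periodic \<Sigma> n b S" and a: "a \<in> \<Sigma>" and b: "b < count X a"
  shows "X + replicate_mset n a \<in> S \<longleftrightarrow> X \<in> S"
proof
  have rep: "repeat_mset n {#a#} = replicate_mset n a" by (intro multiset_eqI) simp
  have "X \<noteq> {#}" using b by auto
  then show "X + replicate_mset n a \<in> S" if "X \<in> S"
    using periodic_add[OF S that, of "{#a#}"] a by (simp add: rep)
  assume "X + replicate_mset n a \<in> S"
  from periodic_reduce[OF S this] \<open>X \<noteq> {#}\<close> obtain Y Z where
    YZ: "Y \<in> S" "set_mset Z \<subseteq> \<Sigma>" "X + replicate_mset n a = Y + repeat_mset n Z" "size Y \<le> b" "Y \<noteq> {#}"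
    by auto
  have "count Y a < count X a"
    using count_le_size[of Y a] YZ(4) b by linarith
  moreover have eq: "count X a + n = count Y a + n * count Z a"
    using arg_cong[OF YZ(3), of "\<lambda>M. count M a"] by simp
  ultimately have "0 < count Z a" by (cases "count Z a") auto
  then obtain Z' where Z: "Z = add_mset a Z'"
    by (metis count_greater_zero_iff multi_member_split)
  have "repeat_mset n Z = repeat_mset n Z' + replicate_mset n a"
    by (intro multiset_eqI) (simp add: Z)
  then have "X = Y + repeat_mset n Z'" using YZ(3) by simp
  then show "X \<in> S" using periodic_add[OF S YZ(1) YZ(5), of Z'] YZ(2) Z by simp
qed

lemma periodic_mono:
  assumes S: "periodic \<Sigma> n b S" and "b \<le> b'"
  shows "periodic \<Sigma> n b' S"
proof (rule periodicI)
  fix X assume X: "X \<in> S"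
  show "\<exists>Y\<in>S. \<exists>Z. set_mset Z \<subseteq> \<Sigma> \<and> X = Y + repeat_mset n Z \<and> size Y \<le> b' \<and> (X \<noteq> {#} \<longrightarrow> Y \<noteq> {#})"
    using periodic_reduce[OF S X] \<open>b \<le> b'\<close> order.trans by blast
qed (use periodic_alphabet[OF S] periodic_add[OF S] in auto)

lemma periodic_Un:
  assumes "periodic \<Sigma> n b S" "periodic \<Sigma> n b T"
  shows "periodic \<Sigma> n b (S \<union> T)"
proof (rule periodicI)
  fix X assume "X \<in> S \<union> T"
  then obtain R where R: "X \<in> R" "R \<subseteq> S \<union> T" "periodic \<Sigma> n b R" using assms by blast
  then show "set_mset X \<subseteq> \<Sigma>" by (simp add: periodic_alphabet)
  show "X + repeat_mset n Z \<in> S \<union> T" if "X \<noteq> {#}" "set_mset Z \<subseteq> \<Sigma>" for Z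
    using periodic_add[OF R(3,1) that] R(2) by blast
  show "\<exists>Y\<in>S \<union> T. \<exists>Z. set_mset Z \<subseteq> \<Sigma> \<and> X = Y + repeat_mset n Z \<and> size Y \<le> b \<and> (X \<noteq> {#} \<longrightarrow> Y \<noteq> {#})"
    using periodic_reduce[OF R(3,1)] R(2) by blast
qed

section \<open>Sums and generated submonoids of periodic sets\<close>

definition msum :: "'a multiset set \<Rightarrow> 'a multiset set \<Rightarrow> 'a multiset set" where
  "msum S T = {X + Y | X Y. X \<in> S \<and> Y \<in> T}"

lemma periodic_msum:
  assumes S: "periodic \<Sigma> n b S" and T: "periodic \<Sigma> n c T"
  shows "periodic \<Sigma> n (b + c) (msum S T)"
proof (rule periodicI)
  fix X assume "X \<in> msum S T"
  then obtain U V where X: "X = U + V" "U \<in> S" "V \<in> T" by (auto simp: msum_def)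
  show "set_mset X \<subseteq> \<Sigma>"
    using X periodic_alphabet[OF S] periodic_alphabet[OF T] by auto
  show "X + repeat_mset n Z \<in> msum S T" if "X \<noteq> {#}" and Z: "set_mset Z \<subseteq> \<Sigma>" for Z
  \<comment> \<open>The multiple is absorbed by a nonempty summand, since closure says nothing about
    the empty one.\<close>
  proof (cases "U = {#}")
    case True
    then have "V + repeat_mset n Z \<in> T" using that X periodic_add[OF T] by auto
    then show ?thesis using X unfolding msum_def by (auto simp: add.assoc)
  next
    case False
    then have "U + repeat_mset n Z \<in> S" using Z X periodic_add[OF S] by auto
    then show ?thesis using X unfolding msum_def
      by (intro CollectI exI[of _ "U + repeat_mset n Z"] exI[of _ V]) (simp add: ac_simps)
  qed
  obtain U' Z where U: "U' \<in> S" "set_mset Z \<subseteq> \<Sigma>" "U = U' + repeat_mset n Z" "size U' \<le> b" "U \<noteq> {#} \<longrightarrow> U' \<noteq> {#}"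
    using periodic_reduce[OF S X(2)] by blast
  obtain V' Z' where V: "V' \<in> T" "set_mset Z' \<subseteq> \<Sigma>" "V = V' + repeat_mset n Z'" "size V' \<le> c" "V \<noteq> {#} \<longrightarrow> V' \<noteq> {#}"
    using periodic_reduce[OF T X(3)] by blast
  show "\<exists>Y\<in>msum S T. \<exists>Z. set_mset Z \<subseteq> \<Sigma> \<and> X = Y + repeat_mset n Z \<and> size Y \<le> b + c \<and> (X \<noteq> {#} \<longrightarrow> Y \<noteq> {#})"
  proof (intro bexI[of _ "U' + V'"] exI[of _ "Z + Z'"] conjI)
    show "X = U' + V' + repeat_mset n (Z + Z')"
      using X U V by (simp add: ac_simps)
    show "X \<noteq> {#} \<longrightarrow> U' + V' \<noteq> {#}" using U V X by auto
    show "U' + V' \<in> msum S T" using U V by (auto simp: msum_def)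
  qed (use U(2,4) V(2,4) in auto)
qed

definition mstar :: "'a multiset set \<Rightarrow> 'a multiset set" where
  "mstar S = {sum_list Xs | Xs. set Xs \<subseteq> S}"

text \<open>The summands are reduced one at a time. The bound grows with their number, so it becomes
  uniform only after \<open>shorten_list\<close> has limited that number.\<close>

lemma reduce_list:
  assumes S: "periodic \<Sigma> n b S" and "set Xs \<subseteq> S"
  shows "\<exists>Ys Z. set Ys \<subseteq> S \<and> set_mset Z \<subseteq> \<Sigma> \<and> sum_list Xs = sum_list Ys + repeat_mset n Z \<and>
    size (sum_list Ys) \<le> length Xs * b \<and> (sum_list Xs \<noteq> {#} \<longrightarrow> sum_list Ys \<noteq> {#})"
  using assms(2)
proof (induction Xs)
  case Nil
  then show ?case by (intro exI[of _ "[]"] exI[of _ "{#}"]) simp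
next
  case (Cons X Xs)
  then have "set Xs \<subseteq> S" by simp
  from Cons.IH[OF this] obtain Ys Z where Ys: "set Ys \<subseteq> S" "set_mset Z \<subseteq> \<Sigma>" "sum_list Xs = sum_list Ys + repeat_mset n Z"
    "size (sum_list Ys) \<le> length Xs * b" "sum_list Xs \<noteq> {#} \<longrightarrow> sum_list Ys \<noteq> {#}"
    by blast
  obtain Y Z' where Y: "Y \<in> S" "set_mset Z' \<subseteq> \<Sigma>" "X = Y + repeat_mset n Z'" "size Y \<le> b" "X \<noteq> {#} \<longrightarrow> Y \<noteq> {#}"
    using periodic_reduce[OF S, of X] Cons.prems by auto
  show ?case
  proof (intro exI[of _ "Y # Ys"] exI[of _ "Z' + Z"] conjI)
    show "sum_list (X # Xs) = sum_list (Y # Ys) + repeat_mset n (Z' + Z)"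
      using Ys(3) Y(3) by (simp add: ac_simps)
    show "sum_list (X # Xs) \<noteq> {#} \<longrightarrow> sum_list (Y # Ys) \<noteq> {#}"
      using Ys(5) Y(5) by auto
  qed (use Y(1,2,4) Ys(1,2,4) in auto)
qed

lemma sum_list_mset_subset:
  "set Xs \<subseteq> S \<Longrightarrow> (\<And>X. X \<in> S \<Longrightarrow> set_mset X \<subseteq> \<Sigma>) \<Longrightarrow> set_mset (sum_list Xs) \<subseteq> \<Sigma>"
  by (induction Xs) auto

text \<open>A sum of more than \<^term>\<open>n ^ card \<Sigma>\<close> summands has a nonempty block of summands adding up to a
  multiple of \<^term>\<open>n\<close>; such blocks are removed, keeping the first summand.\<close>

lemma shorten_list:
  fixes Xs :: "'a multiset list"
  assumes fin: "finite \<Sigma>" and n: "0 < n" and S: "\<And>X. X \<in> S \<Longrightarrow> set_mset X \<subseteq> \<Sigma>"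
    and "set Xs \<subseteq> S" "{#} \<notin> set Xs"
  shows "\<exists>Ys Z. set Ys \<subseteq> S \<and> {#} \<notin> set Ys \<and> (Xs \<noteq> [] \<longrightarrow> Ys \<noteq> []) \<and> set_mset Z \<subseteq> \<Sigma> \<and>
    sum_list Xs = sum_list Ys + repeat_mset n Z \<and> length Ys \<le> Suc (n ^ card \<Sigma>)"
  using assms(4,5)
proof (induction "length Xs" arbitrary: Xs rule: less_induct)
  case less
  show ?case
  proof (cases "length Xs \<le> Suc (n ^ card \<Sigma>)")
    case True
    then show ?thesis using less.prems by (intro exI[of _ Xs] exI[of _ "{#}"]) simp
  next
    case False
    then obtain X Vs where Xs: "Xs = X # Vs" by (cases Xs) auto
    obtain i j where ij: "i < j" "j \<le> length Vs"
      and res: "\<And>a. a \<in> \<Sigma> \<Longrightarrow> count (sum_list (take i Vs)) a mod n = count (sum_list (take j Vs)) a mod n"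
    proof (rule repeated_state_and_residues[of \<Sigma> n "{()}" "length Vs" "\<lambda>_. ()" "\<lambda>i. sum_list (take i Vs)"])
      show "card {()} * n ^ card \<Sigma> \<le> length Vs" using False Xs by simp
    qed (use fin n in auto)
    define us where "us = take (j - i) (drop i Vs)"
    have take_j: "take j Vs = take i Vs @ us"
      using ij by (simp add: us_def flip: take_add)
    have Vs: "Vs = take i Vs @ us @ drop j Vs"
      by (metis append.assoc append_take_drop_id take_j)
    have "set us \<subseteq> S" using less.prems Xs Vs by (metis append_assoc le_sup_iff set_append set_subset_Cons subset_trans)
    then have us: "set_mset (sum_list us) \<subseteq> \<Sigma>" using S by (rule sum_list_mset_subset)
    have "n dvd count (sum_list us) a" for a
    proof (cases "a \<in> \<Sigma>")
      case True
      from res[OF this] have "(count (sum_list (take i Vs)) a + count (sum_list us) a) mod n = count (sum_list (take i Vs)) a mod n"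
        by (simp add: take_j)
      then show ?thesis
        by (metis add_diff_cancel_left' le_add1 mod_eq_dvd_iff_nat)
    next
      case False
      then show ?thesis using us by (metis count_eq_zero_iff dvd_0_right subsetD)
    qed
    then obtain Z where Z: "sum_list us = repeat_mset n Z" "set_mset Z \<subseteq> \<Sigma>"
      using repeat_mset_if_dvd_count us by (metis subset_trans)
    define Ws where "Ws = X # take i Vs @ drop j Vs"
    have sum: "sum_list Xs = sum_list Ws + repeat_mset n Z"
      unfolding Ws_def Xs by (subst Vs) (simp add: Z ac_simps)
    have "length Ws < length Xs" using ij by (simp add: Ws_def Xs)
    moreover have "set Ws \<subseteq> set Xs" unfolding Ws_def Xs by (auto dest: in_set_takeD in_set_dropD)
    ultimately have "length Ws < length Xs" "set Ws \<subseteq> S" "{#} \<notin> set Ws"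
      using less.prems by auto
    from less.hyps[OF this] obtain Ys Z' where Ys: "set Ys \<subseteq> S" "{#} \<notin> set Ys" "Ws \<noteq> [] \<longrightarrow> Ys \<noteq> []" "set_mset Z' \<subseteq> \<Sigma>"
      "sum_list Ws = sum_list Ys + repeat_mset n Z'" "length Ys \<le> Suc (n ^ card \<Sigma>)"
      by blast
    show ?thesis
    proof (intro exI[of _ Ys] exI[of _ "Z' + Z"] conjI)
      show "sum_list Xs = sum_list Ys + repeat_mset n (Z' + Z)"
        unfolding sum Ys(5) by simp
    qed (use Ys(1,2,3,4,6) Z(2) in \<open>auto simp: Ws_def\<close>)
  qed
qed

text \<open>The factor \<open>Suc (n ^ card \<Sigma>)\<close> is the largest number of summands that
  \<open>shorten_list\<close> leaves; each of them is then reduced to size at most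
  \<open>b\<close>.\<close>

lemma periodic_mstar:
  fixes S :: "'a multiset set"
  assumes fin: "finite \<Sigma>" and n: "0 < n" and S: "periodic \<Sigma> n b S"
  shows "periodic \<Sigma> n (Suc (n ^ card \<Sigma>) * b) (mstar S)"
proof (rule periodicI)
  fix X assume "X \<in> mstar S"
  then obtain Xs0 where Xs0: "X = sum_list Xs0" "set Xs0 \<subseteq> S" by (auto simp: mstar_def)
  \<comment> \<open>Without empty summands a nonempty list has a nonempty sum, so the generator
    obtained for a nonempty \<open>X\<close> is nonempty as well.\<close>
  define Xs where "Xs = filter (\<lambda>Y. Y \<noteq> {#}) Xs0"
  have "sum_list (filter (\<lambda>Y. Y \<noteq> {#}) Vs) = sum_list Vs" for Vs :: "'a multiset list" by (induction Vs) auto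
  then have Xs: "X = sum_list Xs" "set Xs \<subseteq> S" "{#} \<notin> set Xs" using Xs0 by (auto simp: Xs_def)
  show "set_mset X \<subseteq> \<Sigma>"
    using sum_list_mset_subset[OF Xs(2)] periodic_alphabet[OF S] Xs(1) by blast
  show "X + repeat_mset n Z \<in> mstar S" if "X \<noteq> {#}" and Z: "set_mset Z \<subseteq> \<Sigma>" for Z
  proof -
    obtain V Vs where V: "Xs = V # Vs" using \<open>X \<noteq> {#}\<close> Xs(1) by (cases Xs) auto
    then have "V + repeat_mset n Z \<in> S" using Xs periodic_add[OF S _ _ Z, of V] by auto
    then have "sum_list ((V + repeat_mset n Z) # Vs) \<in> mstar S"
      unfolding mstar_def using Xs V by (intro CollectI exI[of _ "(V + repeat_mset n Z) # Vs"]) auto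
    then show ?thesis by (simp add: Xs(1) V ac_simps)
  qed
  obtain Ys Z where Ys: "set Ys \<subseteq> S" "{#} \<notin> set Ys" "Xs \<noteq> [] \<longrightarrow> Ys \<noteq> []" "set_mset Z \<subseteq> \<Sigma>"
    "sum_list Xs = sum_list Ys + repeat_mset n Z" "length Ys \<le> Suc (n ^ card \<Sigma>)"
    using shorten_list[OF fin n periodic_alphabet[OF S] Xs(2,3)] by blast
  obtain Ws Z' where Ws: "set Ws \<subseteq> S" "set_mset Z' \<subseteq> \<Sigma>" "sum_list Ys = sum_list Ws + repeat_mset n Z'"
    "size (sum_list Ws) \<le> length Ys * b" "sum_list Ys \<noteq> {#} \<longrightarrow> sum_list Ws \<noteq> {#}"
    using reduce_list[OF S Ys(1)] by blast
  have nonempty: "sum_list Ys \<noteq> {#}" if "Ys \<noteq> []" using that Ys(2) by (cases Ys) auto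
  show "\<exists>Y\<in>mstar S. \<exists>Z. set_mset Z \<subseteq> \<Sigma> \<and> X = Y + repeat_mset n Z \<and> size Y \<le> Suc (n ^ card \<Sigma>) * b \<and> (X \<noteq> {#} \<longrightarrow> Y \<noteq> {#})"
  proof (intro bexI[of _ "sum_list Ws"] exI[of _ "Z + Z'"] conjI)
    show "X = sum_list Ws + repeat_mset n (Z + Z')"
      using Xs(1) Ys(5) Ws(3) by (simp add: ac_simps)
    have "length Ys * b \<le> Suc (n ^ card \<Sigma>) * b" using Ys(6) by (rule mult_le_mono1)
    then show "size (sum_list Ws) \<le> Suc (n ^ card \<Sigma>) * b" using Ws(4) by (rule le_trans[rotated])
    show "X \<noteq> {#} \<longrightarrow> sum_list Ws \<noteq> {#}" using nonempty Ys(3) Ws(5) Xs(1) by fastforce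
    show "sum_list Ws \<in> mstar S" using Ws(1) unfolding mstar_def by blast
  qed (use Ys(4) Ws(2) in auto)
qed

section \<open>Languages of permutation automata\<close>

lemma permutation_funpow_fact:
  assumes f: "bij_betw f Q Q" and "finite Q" "card Q \<le> m" and q: "q \<in> Q"
  shows "(f ^^ fact m) q = q"
proof -
  have Q: "(f ^^ i) q \<in> Q" for i using q bij_betwE[OF f] by (induction i) auto
  have "card ((\<lambda>i. (f ^^ i) q) ` {..card Q}) \<le> card Q"
    using Q \<open>finite Q\<close> by (intro card_mono) auto
  also have "\<dots> < card {..card Q}" by simp
  finally have "\<not> inj_on (\<lambda>i. (f ^^ i) q) {..card Q}" by (rule pigeonhole)
  then obtain i j where ij: "i < j" "j \<le> card Q" "(f ^^ i) q = (f ^^ j) q"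
    unfolding inj_on_def by (metis atMost_iff linorder_neqE_nat)
  \<comment> \<open>Cancelling the first \<open>i\<close> iterates shows that the orbit returns to
    \<open>q\<close> itself instead of merely becoming periodic. The period \<open>j - i\<close> is
    at most \<open>m\<close> and so divides \<open>fact m\<close>.\<close>
  have inj: "(f ^^ i) p = (f ^^ i) p' \<Longrightarrow> p = p'" if "p \<in> Q" "p' \<in> Q" for p p'
    using bij_betw_funpow[OF f, of i] that by (auto simp: bij_betw_def inj_on_def)
  have "(f ^^ i) ((f ^^ (j - i)) q) = (f ^^ i) q"
    using ij by (metis add_diff_inverse_nat comp_apply funpow_add less_imp_not_less)
  then have period: "(f ^^ (j - i)) q = q" using inj Q q by blast
  have "(f ^^ (k * (j - i))) q = q" for k
    by (induction k) (simp_all add: funpow_add period)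
  moreover have "(j - i) dvd fact m" using ij assms(3) by (intro dvd_fact) auto
  ultimately show ?thesis by (metis dvdE mult.commute)
qed

lemma automaton_foldl_states:
  assumes "automaton A" "q \<in> states A" "w \<in> lists (alphabet A)"
  shows "foldl (transition A) q w \<in> states A"
  using assms(3,2)
proof (induction w arbitrary: q rule: lists.induct)
  case (Cons a w)
  then show ?case using assms(1) by (simp add: automaton_def)
qed simp

text \<open>Blocks \<open>a ^ n\<close> with \<open>n = fact m\<close> act trivially on the states of a permutation automaton.\<close>

lemma periodic_permutation_automaton:
  assumes A: "permutation_automaton A" and m: "card (states A) \<le> m"
  shows "periodic (alphabet A) (fact m) (Suc (card (states A) * fact m ^ card (alphabet A))) (mset ` language A)"
    (is "periodic ?\<Sigma> ?n ?b _")
proof (rule periodicI)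
  have aut: "automaton A" using A by (simp add: permutation_automaton_def)
  then have init: "initial A \<in> states A" by (simp add: automaton_def)
  fix X assume "X \<in> mset ` language A"
  then obtain w where w: "X = mset w" "w \<in> language A" by blast
  then have lists: "w \<in> lists ?\<Sigma>" by (simp add: language_def)
  then show "set_mset X \<subseteq> ?\<Sigma>" using w by auto
  show "X + repeat_mset ?n Z \<in> mset ` language A" if "X \<noteq> {#}" and Z: "set_mset Z \<subseteq> ?\<Sigma>" for Z
  proof -
    have block: "foldl (transition A) q (replicate k a) = ((\<lambda>q. transition A q a) ^^ k) q" for q a k
      by (induction k arbitrary: q) (simp_all add: funpow_swap1[of "\<lambda>q. transition A q a"])
    obtain z where z: "mset z = Z" by (metis ex_mset)
    have trivial: "foldl (transition A) q (concat (map (replicate ?n) z)) = q"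
      if "q \<in> states A" "set z \<subseteq> ?\<Sigma>" for q z
      using that(2)
    proof (induction z)
      case (Cons a z)
      have "((\<lambda>q. transition A q a) ^^ ?n) q = q"
        using A aut m that Cons.prems
        by (intro permutation_funpow_fact) (auto simp: permutation_automaton_def automaton_def)
      with Cons show ?case by (simp add: block)
    qed simp
    \<comment> \<open>Only letter counts matter, so all blocks may be put in front of
      \<open>w\<close>, where they fix the initial state.\<close>
    have "foldl (transition A) (initial A) (concat (map (replicate ?n) z)) = initial A"
      using trivial init z Z by auto
    then have "concat (map (replicate ?n) z) @ w \<in> language A"
      using w z Z by (auto simp: language_def)
    moreover have "mset (concat (map (replicate ?n) zs)) = repeat_mset ?n (mset zs)" for zs :: "'a list"
      by (induction zs) auto
    then have "mset (concat (map (replicate ?n) z) @ w) = X + repeat_mset ?n Z"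
      using w z by simp
    ultimately show ?thesis by (metis imageI)
  qed
  have "\<exists>v\<in>language A. \<exists>Z. set_mset Z \<subseteq> ?\<Sigma> \<and> mset w = mset v + repeat_mset ?n Z \<and> length v \<le> ?b \<and> (w \<noteq> [] \<longrightarrow> v \<noteq> [])"
    using w(2)
  proof (induction "length w" arbitrary: w rule: less_induct)
    case less
    show ?case
    proof (cases "length w \<le> ?b")
      case True
      then show ?thesis using less.prems by (intro bexI[of _ w] exI[of _ "{#}"]) simp_all
    next
      case False
      \<comment> \<open>The first letter is kept out of the part to be cut, so the shortened word is
        never empty.\<close>
      then obtain a v where av: "w = a # v" by (cases w) auto
      let ?q = "\<lambda>i. foldl (transition A) (initial A) (a # take i v)"
      have lists: "set w \<subseteq> ?\<Sigma>" using less.prems by (auto simp: language_def)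
      then have v: "set v \<subseteq> ?\<Sigma>" "a \<in> ?\<Sigma>" using av by auto
      obtain i j where ij: "i < j" "j \<le> length v" "?q i = ?q j"
        and res: "\<And>a. a \<in> ?\<Sigma> \<Longrightarrow> count (mset (take i v)) a mod ?n = count (mset (take j v)) a mod ?n"
      proof (rule repeated_state_and_residues[of ?\<Sigma> ?n "states A" "length v" ?q "\<lambda>i. mset (take i v)"])
        show "?q i \<in> states A" for i
          using v by (intro automaton_foldl_states aut init) (auto dest: in_set_takeD)
        show "card (states A) * ?n ^ card ?\<Sigma> \<le> length v" using False av by simp
      qed (use aut in \<open>auto simp: automaton_def\<close>)
      \<comment> \<open>\<open>u\<close> is read between two visits to the same state with the same
        residues: deleting it preserves acceptance and removes a multiple of
        \<open>?n\<close>.\<close>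
      define u where "u = take (j - i) (drop i v)"
      have take_j: "take j v = take i v @ u"
        using ij by (simp add: u_def flip: take_add)
      have v_eq: "v = take i v @ u @ drop j v"
        by (metis append.assoc append_take_drop_id take_j)
      then have u: "set u \<subseteq> ?\<Sigma>" using v by (metis le_sup_iff set_append)
      have "?n dvd count (mset u) b" for b
      proof (cases "b \<in> ?\<Sigma>")
        case True
        from res[OF this] have "(count (mset (take i v)) b + count (mset u) b) mod ?n = count (mset (take i v)) b mod ?n"
          by (simp add: take_j)
        then show ?thesis
          by (metis add_diff_cancel_left' le_add1 mod_eq_dvd_iff_nat)
      next
        case False
        then show ?thesis using u by (metis count_mset_0_iff dvd_0_right subsetD)
      qed
      then obtain Z where Z: "mset u = repeat_mset ?n Z" "set_mset Z \<subseteq> ?\<Sigma>"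
        using repeat_mset_if_dvd_count u by (metis set_mset_mset subset_trans)
      define w' where "w' = a # take i v @ drop j v"
      have sum: "mset w = mset w' + repeat_mset ?n Z"
        unfolding w'_def av by (subst v_eq) (simp add: Z ac_simps)
      have "foldl (transition A) (initial A) w' = foldl (transition A) (?q i) (drop j v)"
        by (simp add: w'_def)
      also have "\<dots> = foldl (transition A) (?q j) (drop j v)" using ij by simp
      also have "\<dots> = foldl (transition A) (initial A) w"
        by (simp add: av flip: foldl_append)
      finally have "w' \<in> language A"
        using less.prems lists v unfolding language_def
        by (auto simp: w'_def dest: in_set_takeD in_set_dropD)
      moreover have "length w' < length w" using ij by (simp add: w'_def av)
      ultimately obtain v' Z' where v': "v' \<in> language A" "set_mset Z' \<subseteq> ?\<Sigma>"
        "mset w' = mset v' + repeat_mset ?n Z'" "length v' \<le> ?b" "w' \<noteq> [] \<longrightarrow> v' \<noteq> []"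
        using less.hyps[of w'] by blast
      show ?thesis
      proof (intro bexI[of _ v'] exI[of _ "Z' + Z"] conjI)
        show "mset w = mset v' + repeat_mset ?n (Z' + Z)"
          unfolding sum v'(3) by simp
      qed (use v'(1,2,4,5) Z(2) in \<open>auto simp: w'_def\<close>)
    qed
  qed
  then show "\<exists>Y\<in>mset ` language A. \<exists>Z. set_mset Z \<subseteq> ?\<Sigma> \<and> X = Y + repeat_mset ?n Z \<and> size Y \<le> ?b \<and> (X \<noteq> {#} \<longrightarrow> Y \<noteq> {#})"
    unfolding w(1) by (metis imageI mset_zero_iff size_mset)
qed


section \<open>Letter multisets of expressions\<close>

lemma mset_image_conc: "mset ` conc K L = msum (mset ` K) (mset ` L)"
proof
  show "mset ` conc K L \<subseteq> msum (mset ` K) (mset ` L)"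
    unfolding conc_def msum_def by fastforce
  show "msum (mset ` K) (mset ` L) \<subseteq> mset ` conc K L"
    unfolding conc_def msum_def image_def by clarsimp (metis mset_append)
qed

text \<open>All shuffles of two words have the same letters, so this single one accounts for their
  common multiset.\<close>

lemma append_in_shuffles: "u @ v \<in> shuffles u v"
  by (induction u) (auto intro: Cons_in_shuffles_leftI)

lemma mset_image_shuffle: "mset ` shuffle K L = msum (mset ` K) (mset ` L)"
proof
  show "mset ` shuffle K L \<subseteq> msum (mset ` K) (mset ` L)"
    unfolding shuffle_def msum_def by (fastforce dest: mset_shuffles)
  show "msum (mset ` K) (mset ` L) \<subseteq> mset ` shuffle K L"
  proof
    fix X assume "X \<in> msum (mset ` K) (mset ` L)"
    then obtain u v where "u \<in> K" "v \<in> L" "X = mset (u @ v)" by (auto simp: msum_def)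
    then show "X \<in> mset ` shuffle K L"
      using append_in_shuffles[of u v] unfolding shuffle_def by blast
  qed
qed

lemma subset_image_mset_conv: "set Xs \<subseteq> mset ` L \<longleftrightarrow> (\<exists>ws. set ws \<subseteq> L \<and> Xs = map mset ws)"
proof
  show "\<exists>ws. set ws \<subseteq> L \<and> Xs = map mset ws" if "set Xs \<subseteq> mset ` L"
    using that
  proof (induction Xs)
    case (Cons X Xs)
    then obtain w ws where "set ws \<subseteq> L" "Xs = map mset ws" "w \<in> L" "X = mset w" by auto
    then show ?case by (intro exI[of _ "w # ws"]) simp
  qed simp
  show "set Xs \<subseteq> mset ` L" if "\<exists>ws. set ws \<subseteq> L \<and> Xs = map mset ws"
    using that by (metis image_mono image_set)
qed

lemma mset_image_star: "mset ` star L = mstar (mset ` L)"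
proof -
  have "mset (concat ws) = sum_list (map mset ws)" for ws :: "'a list list"
    by (induction ws) auto
  then show ?thesis
    unfolding star_def mstar_def subset_image_mset_conv by (auto simp: image_iff) metis
qed

lemma mset_image_iterated_shuffle: "mset ` iterated_shuffle L = mstar (mset ` L)"
proof -
  have eq: "mset ` shuffle_power n L = {sum_list Xs | Xs. set Xs \<subseteq> mset ` L \<and> length Xs = n}" for n
  proof (induction n)
    case (Suc n)
    show ?case
      unfolding shuffle_power.simps mset_image_shuffle Suc
    proof (intro set_eqI iffI)
      fix X assume "X \<in> msum (mset ` L) {sum_list Xs | Xs. set Xs \<subseteq> mset ` L \<and> length Xs = n}"
      then obtain Y Xs where "Y \<in> mset ` L" "set Xs \<subseteq> mset ` L" "length Xs = n" "X = Y + sum_list Xs"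
        unfolding msum_def by blast
      then show "X \<in> {sum_list Xs | Xs. set Xs \<subseteq> mset ` L \<and> length Xs = Suc n}"
        by (intro CollectI exI[of _ "Y # Xs"]) simp
    next
      fix X assume "X \<in> {sum_list Xs | Xs. set Xs \<subseteq> mset ` L \<and> length Xs = Suc n}"
      then obtain Zs where Zs: "X = sum_list Zs" "set Zs \<subseteq> mset ` L" "length Zs = Suc n" by blast
      then obtain Y Xs where "Zs = Y # Xs" by (cases Zs) auto
      with Zs have "Y \<in> mset ` L" "set Xs \<subseteq> mset ` L" "length Xs = n" "X = Y + sum_list Xs"
        by auto
      then show "X \<in> msum (mset ` L) {sum_list Xs | Xs. set Xs \<subseteq> mset ` L \<and> length Xs = n}"
        unfolding msum_def by blast
    qed
  qed simp
  show ?thesis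
    unfolding iterated_shuffle_def image_UN eq mstar_def by auto
qed

section \<open>Codes of expressions and bounds on generators\<close>

lemma prod_encode_gt_2: "0 < a \<Longrightarrow> b < prod_encode (a, b)"
  unfolding prod_encode_def by (induction b) auto

lemma list_encode_ge: "x \<in> set xs \<Longrightarrow> x \<le> list_encode xs"
proof (induction xs)
  case (Cons y xs)
  then show ?case
    using le_prod_encode_1[of y "list_encode xs"] le_prod_encode_2[of "list_encode xs" y] by auto
qed simp

lemma automaton_code_ge_states: "card (states A) \<le> automaton_code letters A"
  unfolding automaton_code_def by (intro list_encode_ge) simp

lemma prod_encode_gt_nested:
  assumes "0 < t"
  shows "a < prod_encode (t, prod_encode (a, b))" "b < prod_encode (t, prod_encode (a, b))"
  using prod_encode_gt_2[OF assms, of "prod_encode (a, b)"] le_prod_encode_1[of a b] le_prod_encode_2[of b a]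
  by linarith+

text \<open>Compound expressions have positive tags, which makes the pairing strictly increasing.
  Both the exponents of the bounds and the membership recursion rest on this.\<close>

lemma expr_code_less:
  "expr_code letters d < expr_code letters (EShuffle d e)"
  "expr_code letters e < expr_code letters (EShuffle d e)"
  "expr_code letters e < expr_code letters (EIterated_Shuffle e)"
  "expr_code letters d < expr_code letters (EUnion d e)"
  "expr_code letters e < expr_code letters (EUnion d e)"
  "expr_code letters d < expr_code letters (EConc d e)"
  "expr_code letters e < expr_code letters (EConc d e)"
  "expr_code letters e < expr_code letters (EStar e)"
  by (simp_all add: prod_encode_gt_2 prod_encode_gt_nested)

text \<open>One factor for every case: \<open>x * fact x ^ k\<close> covers an automaton with at
  most \<open>x\<close> states, \<open>fact x ^ k\<close> the number of summands left in a star, and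
  2 the doubling in a sum; the 2 also supplies the successors in the first two cases.\<close>

definition gap_bound :: "nat \<Rightarrow> nat \<Rightarrow> nat" where
  "gap_bound k x = x * fact x ^ k + fact x ^ k + 2"

text \<open>If the expression has code \<open>c\<close>, its parts have smaller codes and thus
  bounds at most \<open>gap_bound (card \<Sigma>) x ^ c\<close>; the exponent \<open>Suc c\<close>
  leaves one factor for the outermost operation.\<close>

lemma periodic_expr_language:
  assumes fin: "finite \<Sigma>" and e: "expr_over \<Sigma> e" "expr_code letters e \<le> x"
  shows "periodic \<Sigma> (fact x) (gap_bound (card \<Sigma>) x ^ Suc (expr_code letters e)) (mset ` expr_language e)"
proof -
  let ?n = "fact x :: nat" and ?G = "gap_bound (card \<Sigma>) x"
  have G: "2 \<le> ?G" "Suc (?n ^ card \<Sigma>) \<le> ?G" by (simp_all add: gap_bound_def)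
  have mono: "?G ^ Suc a \<le> ?G ^ b" if "a < b" for a b
    using that G(1) by (intro power_increasing) auto
  have raise: "periodic \<Sigma> ?n (?G ^ b) S" if "periodic \<Sigma> ?n (?G ^ Suc a) S" "a < b" for a b S
    using periodic_mono that mono by blast
  have sum: "periodic \<Sigma> ?n (?G ^ Suc b) (msum S T)"
    if "periodic \<Sigma> ?n (?G ^ b) S" "periodic \<Sigma> ?n (?G ^ b) T" for b S T
    using periodic_mono[OF periodic_msum[OF that]] G(1) by (simp add: mult_le_mono1 flip: mult_2)
  have star: "periodic \<Sigma> ?n (?G ^ Suc b) (mstar S)" if "periodic \<Sigma> ?n (?G ^ b) S" for b S
    using periodic_mono[OF periodic_mstar[OF fin _ that] mult_le_mono1[OF G(2)]] by simp
  show ?thesis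
    using e
  proof (induction e)
    case (EAut A)
    have card: "card (states A) \<le> x"
      using automaton_code_ge_states[of A letters] le_prod_encode_2[of "automaton_code letters A" 0] EAut(2)
      by simp
    then have "Suc (card (states A) * ?n ^ card \<Sigma>) \<le> ?G"
      using mult_le_mono1[OF card, of "?n ^ card \<Sigma>"] unfolding gap_bound_def by linarith
    also have "\<dots> \<le> ?G ^ Suc (expr_code letters (EAut A))" using G(1) by (intro self_le_power) auto
    finally show ?case
      using periodic_mono[OF periodic_permutation_automaton[of A x]] EAut(1) card by fastforce
  next
    case (EShuffle d e)
    note less = expr_code_less(1,2)[where d = d and e = e and letters = letters]
    have "expr_code letters d \<le> x" "expr_code letters e \<le> x" using EShuffle.prems(2) less by linarith+
    then show ?case
      unfolding expr_language.simps mset_image_shuffle using EShuffle.prems(1)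
      by (intro sum raise[OF EShuffle.IH(1) less(1)] raise[OF EShuffle.IH(2) less(2)]) simp_all
  next
    case (EIterated_Shuffle e)
    note less = expr_code_less(3)[where e = e and letters = letters]
    have "expr_code letters e \<le> x" using EIterated_Shuffle.prems(2) less by linarith
    then show ?case
      unfolding expr_language.simps mset_image_iterated_shuffle using EIterated_Shuffle.prems(1)
      by (intro star raise[OF EIterated_Shuffle.IH less]) simp_all
  next
    case (EUnion d e)
    note less = expr_code_less(4,5)[where d = d and e = e and letters = letters]
    have "expr_code letters d \<le> x" "expr_code letters e \<le> x" using EUnion.prems(2) less by linarith+
    then show ?case
      unfolding expr_language.simps image_Un using EUnion.prems(1)
      by (intro periodic_Un raise[OF EUnion.IH(1) less_SucI[OF less(1)]] raise[OF EUnion.IH(2) less_SucI[OF less(2)]]) simp_all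
  next
    case (EConc d e)
    note less = expr_code_less(6,7)[where d = d and e = e and letters = letters]
    have "expr_code letters d \<le> x" "expr_code letters e \<le> x" using EConc.prems(2) less by linarith+
    then show ?case
      unfolding expr_language.simps mset_image_conc using EConc.prems(1)
      by (intro sum raise[OF EConc.IH(1) less(1)] raise[OF EConc.IH(2) less(2)]) simp_all
  next
    case (EStar e)
    note less = expr_code_less(8)[where e = e and letters = letters]
    have "expr_code letters e \<le> x" using EStar.prems(2) less by linarith
    then show ?case
      unfolding expr_language.simps mset_image_star using EStar.prems(1)
      by (intro star raise[OF EStar.IH less]) simp_all
  qed
qed


section \<open>Deciding membership of a letter multiset\<close>

text \<open>The multiset with \<open>c\<^sub>i\<close> copies of letter number \<open>i < k\<close> is coded by the number with the base
  \<^term>\<open>D\<close> digits \<open>c\<^sub>0, \<dots>, c\<^sub>k\<^sub>-\<^sub>1\<close> and leading part the size of the multiset. This makes the code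
  additive, and the size prevents a second multiset from having the same code by a carry.\<close>

definition weight :: "'a list \<Rightarrow> nat \<Rightarrow> 'a multiset \<Rightarrow> nat" where
  "weight letters D X = (\<Sum>i<length letters. count X (letters ! i) * (D ^ i + D ^ length letters))"

lemma weight_empty [simp]: "weight letters D {#} = 0"
  by (simp add: weight_def)

lemma weight_add [simp]: "weight letters D (X + Y) = weight letters D X + weight letters D Y"
  by (simp add: weight_def sum.distrib distrib_right)

lemma weight_replicate:
  assumes "distinct letters" "i < length letters"
  shows "weight letters D (replicate_mset m (letters ! i)) = m * (D ^ i + D ^ length letters)"
proof -
  have "weight letters D (replicate_mset m (letters ! i)) =
    (\<Sum>j<length letters. if i = j then m * (D ^ i + D ^ length letters) else 0)"
    unfolding weight_def using assms by (intro sum.cong) (auto simp: nth_eq_iff_index_eq)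
  then show ?thesis using assms by simp
qed

lemma weight_add_mset:
  assumes "distinct letters" "i < length letters"
  shows "weight letters D (add_mset (letters ! i) X) = D ^ i + D ^ length letters + weight letters D X"
  using weight_replicate[OF assms, of D 1] weight_add[of letters D "{#letters ! i#}" X] by simp

lemma digits:
  fixes f :: "nat \<Rightarrow> nat"
  assumes "\<And>i. i < k \<Longrightarrow> f i < D"
  shows "(\<Sum>i<k. f i * D ^ i) < D ^ k"
    and "i < k \<Longrightarrow> ((\<Sum>i<k. f i * D ^ i) + z * D ^ k) div D ^ i mod D = f i"
  using assms
proof (induction k arbitrary: z)
  case (Suc k)
  { case 1
    then have "(\<Sum>i<k. f i * D ^ i) < D ^ k" "f k < D" using Suc.IH(1) by auto
    then have "(\<Sum>i<Suc k. f i * D ^ i) < Suc (f k) * D ^ k" by simp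
    also have "\<dots> \<le> D * D ^ k" using \<open>f k < D\<close> by (intro mult_le_mono1) simp
    finally show ?case by simp }
  { case 2
    have eq: "(\<Sum>i<Suc k. f i * D ^ i) + z * D ^ Suc k = (\<Sum>i<k. f i * D ^ i) + (f k + z * D) * D ^ k"
      by (simp add: algebra_simps)
    show ?case
    proof (cases "i = k")
      case True
      have "(\<Sum>i<k. f i * D ^ i) < D ^ k" "f k < D" using Suc.IH(1) 2 by auto
      moreover from this have "D ^ k \<noteq> 0" by linarith
      ultimately show ?thesis unfolding eq True by simp
    next
      case False
      then show ?thesis unfolding eq using Suc.IH(2) 2 by auto
    qed }
qed auto

lemma size_letters:
  assumes "distinct letters" "set_mset X \<subseteq> set letters"
  shows "size X = (\<Sum>i<length letters. count X (letters ! i))"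
proof -
  have "size X = sum (count X) (set letters)"
    unfolding size_multiset_overloaded_eq using assms(2)
    by (intro sum.mono_neutral_left) (auto simp: not_in_iff)
  also have "\<dots> = (\<Sum>i<length letters. count X (letters ! i))"
    using assms(1) by (simp add: sum.distinct_set_conv_list sum_list_sum_nth atLeast0LessThan)
  finally show ?thesis .
qed

lemma weight_digits:
  assumes "distinct letters" "set_mset X \<subseteq> set letters"
  shows "weight letters D X =
    (\<Sum>i<length letters. count X (letters ! i) * D ^ i) + size X * D ^ length letters"
  by (simp add: weight_def size_letters[OF assms] distrib_left sum.distrib sum_distrib_right)

lemma weight_digit:
  assumes "distinct letters" "set_mset X \<subseteq> set letters" "size X < D" "i < length letters"
  shows "weight letters D X div D ^ i mod D = count X (letters ! i)"
  unfolding weight_digits[OF assms(1,2)]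
  by (rule digits(2)[OF _ assms(4)]) (rule le_less_trans[OF count_le_size assms(3)])

lemma weight_less:
  assumes "distinct letters" "set_mset X \<subseteq> set letters" "size X < D"
  shows "weight letters D X < Suc (size X) * D ^ length letters"
proof -
  have "(\<Sum>i<length letters. count X (letters ! i) * D ^ i) < D ^ length letters"
    by (rule digits(1)) (rule le_less_trans[OF count_le_size assms(3)])
  then show ?thesis by (simp add: weight_digits[OF assms(1,2)])
qed

text \<open>Only \<open>X\<close> is known to be small, since the membership test may find any
  member of the language with the given weight. The leading part of the common weight bounds the
  size of \<open>Y\<close>, so its digits do not carry either.\<close>

lemma weight_eqD:
  assumes "distinct letters" "set_mset X \<subseteq> set letters" "set_mset Y \<subseteq> set letters" "size X < D"
    and eq: "weight letters D X = weight letters D Y"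
  shows "X = Y"
proof -
  have "size Y * D ^ length letters \<le> weight letters D Y"
    by (simp add: weight_digits[OF assms(1,3)])
  also have "\<dots> < Suc (size X) * D ^ length letters"
    using weight_less[OF assms(1,2,4)] eq by simp
  finally have "size Y < Suc (size X)" by (metis mult_less_cancel2)
  then have Y: "size Y < D" using assms(4) by simp
  show ?thesis
  proof (rule multiset_eqI)
    fix a
    show "count X a = count Y a"
    proof (cases "a \<in> set letters")
      case True
      then show ?thesis
        by (metis assms(1-4) Y eq in_set_conv_nth weight_digit)
    next
      case False
      then show ?thesis using assms(2,3) by (metis count_eq_zero_iff subsetD)
    qed
  qed
qed

lemma weight_image_msum:
  "u \<in> weight letters D ` msum S T \<longleftrightarrow>
    (\<exists>v\<le>u. v \<in> weight letters D ` S \<and> u - v \<in> weight letters D ` T)"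
proof
  assume "u \<in> weight letters D ` msum S T"
  then obtain X Y where "X \<in> S" "Y \<in> T" "u = weight letters D X + weight letters D Y"
    unfolding msum_def by auto
  then show "\<exists>v\<le>u. v \<in> weight letters D ` S \<and> u - v \<in> weight letters D ` T"
    by (intro exI[of _ "weight letters D X"]) simp
next
  assume "\<exists>v\<le>u. v \<in> weight letters D ` S \<and> u - v \<in> weight letters D ` T"
  then obtain X Y where XY: "X \<in> S" "Y \<in> T" "weight letters D X \<le> u" "u - weight letters D X = weight letters D Y"
    by auto
  then have "u = weight letters D (X + Y)" by simp
  then show "u \<in> weight letters D ` msum S T" using XY unfolding msum_def by blast
qed

text \<open>Summands of weight 0 can be skipped without changing the total, and \<open>0 < v\<close>
  makes the right-hand side a recursion on smaller weights.\<close>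

lemma weight_image_mstar:
  "u \<in> weight letters D ` mstar S \<longleftrightarrow>
    u = 0 \<or> (\<exists>v\<le>u. 0 < v \<and> v \<in> weight letters D ` S \<and> u - v \<in> weight letters D ` mstar S)"
proof
  have step: "weight letters D (sum_list Xs) = 0 \<or>
      (\<exists>v\<le>weight letters D (sum_list Xs). 0 < v \<and> v \<in> weight letters D ` S \<and>
        weight letters D (sum_list Xs) - v \<in> weight letters D ` mstar S)"
    if "set Xs \<subseteq> S" for Xs
    using that
  proof (induction Xs)
    case (Cons X Xs)
    show ?case
    proof (cases "weight letters D X = 0")
      case True
      then show ?thesis using Cons by simp
    next
      case False
      moreover have "sum_list Xs \<in> mstar S" using Cons.prems unfolding mstar_def by auto
      ultimately show ?thesis using Cons.prems
        by (intro disjI2 exI[of _ "weight letters D X"]) auto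
    qed
  qed simp
  show "u = 0 \<or> (\<exists>v\<le>u. 0 < v \<and> v \<in> weight letters D ` S \<and> u - v \<in> weight letters D ` mstar S)"
    if u: "u \<in> weight letters D ` mstar S"
  proof -
    obtain Xs where "u = weight letters D (sum_list Xs)" "set Xs \<subseteq> S"
      using u by (auto simp: mstar_def)
    then show ?thesis using step[of Xs] by simp
  qed
  assume "u = 0 \<or> (\<exists>v\<le>u. 0 < v \<and> v \<in> weight letters D ` S \<and> u - v \<in> weight letters D ` mstar S)"
  then show "u \<in> weight letters D ` mstar S"
  proof
    assume "u = 0"
    moreover have "{#} \<in> mstar S" unfolding mstar_def by (intro CollectI exI[of _ "[]"]) simp
    ultimately show ?thesis by (metis imageI weight_empty)
  next
    assume "\<exists>v\<le>u. 0 < v \<and> v \<in> weight letters D ` S \<and> u - v \<in> weight letters D ` mstar S"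
    then obtain X Xs where X: "X \<in> S" "weight letters D X \<le> u" "set Xs \<subseteq> S"
      "u - weight letters D X = weight letters D (sum_list Xs)"
      by (auto simp: mstar_def)
    then have "u = weight letters D (sum_list (X # Xs))" by simp
    moreover have "sum_list (X # Xs) \<in> mstar S"
      using X unfolding mstar_def by (intro CollectI exI[of _ "X # Xs"]) simp
    ultimately show ?thesis by blast
  qed
qed

section \<open>Membership as a course-of-values recursion\<close>

definition letter_weight :: "nat \<Rightarrow> nat \<Rightarrow> nat \<Rightarrow> nat" where
  "letter_weight k D i = D ^ i + D ^ k"

text \<open>The parameter is \<open>(z, k, D)\<close> for the code \<open>z\<close> of an automaton, and the argument \<open>u * Suc z + q\<close>
  asks for a word of weight \<open>u\<close> leading from state \<open>q\<close> to a final state.\<close>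

definition automaton_step :: "nat \<Rightarrow> nat \<Rightarrow> nat \<Rightarrow> bool" where
  "automaton_step p i h \<longleftrightarrow>
     (i div Suc (pfst p) = 0 \<and> code_nth (code_nth (pfst p) 3) (i mod Suc (pfst p)) = 1) \<or>
     (\<exists>j<pfst (psnd p). letter_weight (pfst (psnd p)) (psnd (psnd p)) j \<le> i div Suc (pfst p) \<and>
       (i div Suc (pfst p) - letter_weight (pfst (psnd p)) (psnd (psnd p)) j) * Suc (pfst p) +
         code_nth (code_nth (code_nth (pfst p) 4) (i mod Suc (pfst p))) j \<in> set_decode h)"

text \<open>The parameter is \<open>(k, D)\<close>, and the argument \<open>(y, u)\<close> asks for a word of weight \<open>u\<close> in the language
  of the expression coded by \<open>y\<close>.\<close>

definition expr_step :: "nat \<Rightarrow> nat \<Rightarrow> nat \<Rightarrow> bool" where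
  "expr_step p i h \<longleftrightarrow>
     (if pfst (pfst i) = 0
      then course_rec automaton_step (prod_encode (psnd (pfst i), p))
        (psnd i * Suc (psnd (pfst i)) + code_nth (psnd (pfst i)) 2)
      else if pfst (pfst i) = 1 \<or> pfst (pfst i) = 4
      then \<exists>v<Suc (psnd i). prod_encode (pfst (psnd (pfst i)), v) \<in> set_decode h \<and>
        prod_encode (psnd (psnd (pfst i)), psnd i - v) \<in> set_decode h
      else if pfst (pfst i) = 3
      then prod_encode (pfst (psnd (pfst i)), psnd i) \<in> set_decode h \<or>
        prod_encode (psnd (psnd (pfst i)), psnd i) \<in> set_decode h
      else psnd i = 0 \<or> (\<exists>v<Suc (psnd i). 0 < v \<and> prod_encode (psnd (pfst i), v) \<in> set_decode h \<and>
        prod_encode (pfst i, psnd i - v) \<in> set_decode h))"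

text \<open>The code \<open>z\<close> of an automaton is at least its number of states, so with base
  \<open>Suc z\<close> every state is a valid remainder.\<close>

lemma automaton_step_code:
  assumes "q < Suc z"
  shows "automaton_step (prod_encode (z, prod_encode (k, D))) (u * Suc z + q) h \<longleftrightarrow>
    (u = 0 \<and> code_nth (code_nth z 3) q = 1) \<or>
    (\<exists>j<k. letter_weight k D j \<le> u \<and>
      (u - letter_weight k D j) * Suc z + code_nth (code_nth (code_nth z 4) q) j \<in> set_decode h)"
proof -
  have "(u * Suc z + q) div Suc z = u" "(u * Suc z + q) mod Suc z = q"
    using assms by (simp_all add: add.commute[of _ q] del: mult_Suc_right)
  then show ?thesis
    by (simp only: automaton_step_def prod_encode_inverse fst_conv snd_conv)
qed

lemma expr_step_code:
  "expr_step p (prod_encode (prod_encode (t, b), u)) h \<longleftrightarrow>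
     (if t = 0
      then course_rec automaton_step (prod_encode (b, p)) (u * Suc b + code_nth b 2)
      else if t = 1 \<or> t = 4
      then \<exists>v<Suc u. prod_encode (pfst b, v) \<in> set_decode h \<and> prod_encode (psnd b, u - v) \<in> set_decode h
      else if t = 3
      then prod_encode (pfst b, u) \<in> set_decode h \<or> prod_encode (psnd b, u) \<in> set_decode h
      else u = 0 \<or> (\<exists>v<Suc u. 0 < v \<and> prod_encode (b, v) \<in> set_decode h \<and>
        prod_encode (prod_encode (t, b), u - v) \<in> set_decode h))"
  by (simp only: expr_step_def prod_encode_inverse fst_conv snd_conv)

lemma computable_letter_weight [computable_intros]:
  assumes "computable f" "computable g" "computable h"
  shows "computable (\<lambda>x. letter_weight (f x) (g x) (h x))"
  unfolding letter_weight_def by (intro computable_intros assms)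

lemma decidable_automaton_rec [computable_intros]:
  assumes "computable f" "computable g"
  shows "decidable (\<lambda>x. course_rec automaton_step (f x) (g x))"
proof (rule decidable_course_rec[OF _ assms])
  show "decidable (\<lambda>z. automaton_step (pfst z) (pfst (psnd z)) (psnd (psnd z)))"
    unfolding automaton_step_def by (intro computable_intros)
qed

lemma decidable_expr_rec [computable_intros]:
  assumes "computable f" "computable g"
  shows "decidable (\<lambda>x. course_rec expr_step (f x) (g x))"
proof (rule decidable_course_rec[OF _ assms])
  show "decidable (\<lambda>z. expr_step (pfst z) (pfst (psnd z)) (psnd (psnd z)))"
    unfolding expr_step_def by (intro computable_intros)
qed

lemma automaton_code_nth:
  assumes A: "automaton A" "standard_states A"
  shows "code_nth (automaton_code letters A) 0 = length letters"
    and "code_nth (automaton_code letters A) 2 = initial A"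
    and "q \<in> states A \<Longrightarrow> code_nth (code_nth (automaton_code letters A) 3) q = of_bool (q \<in> final A)"
    and "q \<in> states A \<Longrightarrow> j < length letters \<Longrightarrow>
      code_nth (code_nth (code_nth (automaton_code letters A) 4) q) j = transition A q (letters ! j)"
    and "q \<in> states A \<Longrightarrow> q < Suc (automaton_code letters A)"
proof -
  have states: "q \<in> states A \<longleftrightarrow> q < card (states A)" for q
    using A(2) by (metis lessThan_iff standard_states_def)
  show "code_nth (automaton_code letters A) 0 = length letters" "code_nth (automaton_code letters A) 2 = initial A"
    by (simp_all add: automaton_code_def code_nth_list_encode del: list_encode.simps)
  assume q: "q \<in> states A"
  then show "code_nth (code_nth (automaton_code letters A) 3) q = of_bool (q \<in> final A)"
    by (simp add: automaton_code_def code_nth_list_encode states del: list_encode.simps)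
  show "q < Suc (automaton_code letters A)"
    using q automaton_code_ge_states[of A letters] states by fastforce
  show "code_nth (code_nth (code_nth (automaton_code letters A) 4) q) j = transition A q (letters ! j)"
    if "j < length letters"
    using q that by (simp add: automaton_code_def code_nth_list_encode states del: list_encode.simps)
qed

lemma automaton_rec:
  assumes A: "automaton A" "standard_states A" "alphabet A = set letters" and letters: "distinct letters"
    and D: "0 < D" and q: "q \<in> states A"
  defines "z \<equiv> automaton_code letters A"
  shows "course_rec automaton_step (prod_encode (z, prod_encode (length letters, D))) (u * Suc z + q) \<longleftrightarrow>
    (\<exists>w\<in>lists (set letters). weight letters D (mset w) = u \<and> foldl (transition A) q w \<in> final A)"
  using q
proof (induction u arbitrary: q rule: less_induct)
  case (less u)
  let ?rec = "course_rec automaton_step (prod_encode (z, prod_encode (length letters, D)))"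
  let ?lw = "letter_weight (length letters) D"
  let ?word = "\<lambda>u q w. w \<in> lists (set letters) \<and> weight letters D (mset w) = u \<and> foldl (transition A) q w \<in> final A"
  have lw: "0 < ?lw j" for j using D by (simp add: letter_weight_def)
  have qz: "q < Suc z" using automaton_code_nth(5)[OF A(1,2) less.prems] by (simp add: z_def)
  have step: "transition A q (letters ! j) \<in> states A" if "j < length letters" for j
    using that less.prems A by (simp add: automaton_def)
  \<comment> \<open>A letter lowers the weight by at least 1 and thus the argument by at least
    \<open>Suc z\<close>, which outweighs any change of state.\<close>
  have smaller: "(u - ?lw j) * Suc z + transition A q (letters ! j) < u * Suc z + q"
    if "j < length letters" "?lw j \<le> u" for j
  proof -
    have "transition A q (letters ! j) < Suc z"
      using automaton_code_nth(5)[OF A(1,2) step[OF that(1)]] by (simp add: z_def)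
    moreover have "Suc (u - ?lw j) * Suc z \<le> u * Suc z"
      using lw[of j] that by (intro mult_le_mono1) linarith
    ultimately show ?thesis by simp
  qed
  have "?rec (u * Suc z + q) \<longleftrightarrow> (u = 0 \<and> q \<in> final A) \<or>
    (\<exists>j<length letters. ?lw j \<le> u \<and> ?rec ((u - ?lw j) * Suc z + transition A q (letters ! j)))"
    (is "_ \<longleftrightarrow> _ \<or> ?ex")
  proof -
    have final: "code_nth (code_nth z 3) q = 1 \<longleftrightarrow> q \<in> final A"
      using automaton_code_nth(3)[OF A(1,2) less.prems] by (simp add: z_def)
    have trans: "code_nth (code_nth (code_nth z 4) q) j = transition A q (letters ! j)" if "j < length letters" for j
      using automaton_code_nth(4)[OF A(1,2) less.prems that] by (simp add: z_def)
    show ?thesis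
      unfolding course_rec_def[of automaton_step _ "u * Suc z + q"] automaton_step_code[OF qz]
        set_decode_history final mem_Collect_eq
      using smaller trans by (metis (no_types, lifting))
  qed
  also have "?ex \<longleftrightarrow> (\<exists>j<length letters. ?lw j \<le> u \<and> (\<exists>w. ?word (u - ?lw j) (transition A q (letters ! j)) w))"
    proof -
    have "?rec ((u - ?lw j) * Suc z + transition A q (letters ! j)) \<longleftrightarrow>
        (\<exists>w. ?word (u - ?lw j) (transition A q (letters ! j)) w)" if "j < length letters" "?lw j \<le> u" for j
      using less.IH[OF _ step[OF that(1)], of "u - ?lw j"] lw[of j] that by (simp add: Bex_def)
    then show ?thesis by blast
  qed
  also have "\<dots> \<longleftrightarrow> (\<exists>j<length letters. \<exists>w. ?word u q (letters ! j # w))"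
  proof -
    have "?lw j \<le> u \<and> (\<exists>w. ?word (u - ?lw j) (transition A q (letters ! j)) w) \<longleftrightarrow> (\<exists>w. ?word u q (letters ! j # w))"
      if "j < length letters" for j
    proof -
      have "weight letters D (mset (letters ! j # w)) = ?lw j + weight letters D (mset w)" for w
        using weight_add_mset[OF letters that] by (simp add: letter_weight_def)
      then have "?word u q (letters ! j # w) \<longleftrightarrow> ?lw j \<le> u \<and> ?word (u - ?lw j) (transition A q (letters ! j)) w" for w
        using that by auto
      then show ?thesis by blast
    qed
    then show ?thesis by blast
  qed
  also have "(u = 0 \<and> q \<in> final A) \<or> \<dots> \<longleftrightarrow> (\<exists>w\<in>lists (set letters). weight letters D (mset w) = u \<and> foldl (transition A) q w \<in> final A)"
    (is "?l \<longleftrightarrow> ?r")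
  proof
    assume ?l
    then show ?r
    proof
      assume "u = 0 \<and> q \<in> final A"
      then show ?r by (intro bexI[of _ "[]"]) auto
    qed blast
  next
    assume ?r
    then obtain w where w: "?word u q w" by blast
    show ?l
    proof (cases w)
      case Nil
      then show ?thesis using w by simp
    next
      case (Cons a w')
      then obtain j where "j < length letters" "a = letters ! j"
        using w by (auto simp: in_set_conv_nth)
      then show ?thesis using w Cons by blast
    qed
  qed
  finally show ?case .
qed

lemma triangle_mono: "m \<le> n \<Longrightarrow> triangle m \<le> triangle n"
  by (induction n) (auto simp: le_Suc_eq)

text \<open>The recursion over expressions either passes to a subexpression with no larger weight or
  keeps the expression and lowers the weight. This fact and the next one show that the paired
  argument decreases in both cases.\<close>

lemma prod_encode_less_1: "a < a' \<Longrightarrow> b \<le> b' \<Longrightarrow> prod_encode (a, b) < prod_encode (a', b')"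
  using triangle_mono[of "a + b" "a' + b'"] by (simp add: prod_encode_def)

lemma prod_encode_less_2: "b < b' \<Longrightarrow> prod_encode (a, b) < prod_encode (a, b')"
  using triangle_mono[of "Suc (a + b)" "a + b'"] by (simp add: prod_encode_def)

lemma expr_rec:
  assumes letters: "distinct letters" and D: "0 < D" and e: "expr_over (set letters) e"
  shows "course_rec expr_step (prod_encode (length letters, D)) (prod_encode (expr_code letters e, u)) \<longleftrightarrow>
    u \<in> weight letters D ` mset ` expr_language e"
  using e
proof (induction e arbitrary: u)
  case (EAut A)
  then have A: "automaton A" "standard_states A" "alphabet A = set letters" "initial A \<in> states A"
    by (auto simp: permutation_automaton_def automaton_def)
  have "course_rec expr_step (prod_encode (length letters, D)) (prod_encode (expr_code letters (EAut A), u)) \<longleftrightarrow>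
    (\<exists>w\<in>lists (set letters). weight letters D (mset w) = u \<and> foldl (transition A) (initial A) w \<in> final A)"
    using automaton_rec[OF A(1-3) letters D A(4), of u] automaton_code_nth(2)[OF A(1,2)]
    by (simp only: course_rec_def[of expr_step] expr_code.simps expr_step_code simp_thms if_True)
  then show ?case by (auto simp: language_def A(3) image_iff)
next
  case (EShuffle d e)
  have less: "prod_encode (expr_code letters d, v) < prod_encode (expr_code letters (EShuffle d e), u)"
    "prod_encode (expr_code letters e, v) < prod_encode (expr_code letters (EShuffle d e), u)" if "v \<le> u" for v
    using that expr_code_less(1,2)[where d = d and e = e and letters = letters] by (simp_all only: prod_encode_less_1)
  show ?case
    using EShuffle less
    unfolding course_rec_def[of expr_step _ "prod_encode (expr_code letters (EShuffle d e), u)"]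
      unfolding expr_code.simps expr_step_code set_decode_history expr_language.simps mset_image_shuffle weight_image_msum
    by (simp add: less_Suc_eq_le cong: conj_cong)
next
  case (EIterated_Shuffle e)
  show ?case
  \<comment> \<open>After one summand is split off, the same expression is queried again with a
    smaller weight; hence the inner induction.\<close>
  proof (induction u rule: less_induct)
    case (less u)
    have smaller: "prod_encode (expr_code letters e, v) < prod_encode (expr_code letters (EIterated_Shuffle e), u)" if "v \<le> u" for v
      using that expr_code_less(3)[where e = e and letters = letters] by (simp only: prod_encode_less_1)
    have "prod_encode (expr_code letters (EIterated_Shuffle e), u - v) < prod_encode (expr_code letters (EIterated_Shuffle e), u)"
      if "v \<le> u" "0 < v" for v
      using that by (intro prod_encode_less_2) simp
    with smaller show ?case
      using EIterated_Shuffle less.IH weight_image_mstar[of u letters D "mset ` expr_language e"]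
      unfolding course_rec_def[of expr_step _ "prod_encode (expr_code letters (EIterated_Shuffle e), u)"]
        unfolding expr_code.simps expr_step_code set_decode_history expr_language.simps mset_image_iterated_shuffle
      by (simp add: less_Suc_eq_le cong: conj_cong)
  qed
next
  case (EUnion d e)
  have less: "prod_encode (expr_code letters d, v) < prod_encode (expr_code letters (EUnion d e), u)"
    "prod_encode (expr_code letters e, v) < prod_encode (expr_code letters (EUnion d e), u)" if "v \<le> u" for v
    using that expr_code_less(4,5)[where d = d and e = e and letters = letters] by (simp_all only: prod_encode_less_1)
  show ?case
    using EUnion less
    unfolding course_rec_def[of expr_step _ "prod_encode (expr_code letters (EUnion d e), u)"]
      unfolding expr_code.simps expr_step_code set_decode_history expr_language.simps image_Un
    by (simp add: less_Suc_eq_le cong: conj_cong)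
next
  case (EConc d e)
  have less: "prod_encode (expr_code letters d, v) < prod_encode (expr_code letters (EConc d e), u)"
    "prod_encode (expr_code letters e, v) < prod_encode (expr_code letters (EConc d e), u)" if "v \<le> u" for v
    using that expr_code_less(6,7)[where d = d and e = e and letters = letters] by (simp_all only: prod_encode_less_1)
  show ?case
    using EConc less
    unfolding course_rec_def[of expr_step _ "prod_encode (expr_code letters (EConc d e), u)"]
      unfolding expr_code.simps expr_step_code set_decode_history expr_language.simps mset_image_conc weight_image_msum
    by (simp add: less_Suc_eq_le cong: conj_cong)
next
  case (EStar e)
  show ?case
  proof (induction u rule: less_induct)
    case (less u)
    have smaller: "prod_encode (expr_code letters e, v) < prod_encode (expr_code letters (EStar e), u)" if "v \<le> u" for v
      using that expr_code_less(8)[where e = e and letters = letters] by (simp only: prod_encode_less_1)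
    have "prod_encode (expr_code letters (EStar e), u - v) < prod_encode (expr_code letters (EStar e), u)"
      if "v \<le> u" "0 < v" for v
      using that by (intro prod_encode_less_2) simp
    with smaller show ?case
      using EStar less.IH weight_image_mstar[of u letters D "mset ` expr_language e"]
      unfolding course_rec_def[of expr_step _ "prod_encode (expr_code letters (EStar e), u)"]
        unfolding expr_code.simps expr_step_code set_decode_history expr_language.simps mset_image_star
      by (simp add: less_Suc_eq_le cong: conj_cong)
  qed
qed


section \<open>The counting automaton\<close>

text \<open>Tags 2 and 5 carry one argument, the other positive tags a pair. Automata are fixed
  points, so surplus iterations do no harm.\<close>

definition leftmost_child :: "nat \<Rightarrow> nat" where
  "leftmost_child y = (if pfst y = 0 then y else if pfst y = 2 \<or> pfst y = 5 then psnd y else pfst (psnd y))"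

text \<open>The algorithm receives only the code of the expression and has to extract the number of
  letters from it. Every automaton inside is coded with the same list of letters, so any leaf will
  do, and \<open>x\<close> descents reach one because each descent lowers the code.\<close>

definition letter_number :: "nat \<Rightarrow> nat" where
  "letter_number x = code_nth (psnd (rec_nat x (\<lambda>_ y. leftmost_child y) x)) 0"

lemma letter_number_expr_code:
  "letter_number (expr_code letters e) = length letters"
proof -
  have shift: "rec_nat y (\<lambda>_ y. leftmost_child y) (Suc m) = rec_nat (leftmost_child y) (\<lambda>_ y. leftmost_child y) m"
    for y m by (induction m) auto
  have aut: "rec_nat (prod_encode (0, z)) (\<lambda>_ y. leftmost_child y) m = prod_encode (0, z)" for z m
    by (induction m) (simp_all add: leftmost_child_def)
  have step: "code_nth (psnd (rec_nat y (\<lambda>_ y. leftmost_child y) m)) 0 = length letters"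
    if "leftmost_child y = y'" "y' < y" "y \<le> m"
      and "\<And>m. y' \<le> m \<Longrightarrow> code_nth (psnd (rec_nat y' (\<lambda>_ y. leftmost_child y) m)) 0 = length letters" for y y' m
  proof -
    obtain m' where "m = Suc m'" "y' \<le> m'" using \<open>y' < y\<close> \<open>y \<le> m\<close> by (cases m) auto
    with that show ?thesis by (simp only: shift)
  qed
  have "code_nth (psnd (rec_nat (expr_code letters e) (\<lambda>_ y. leftmost_child y) m)) 0 = length letters"
    if "expr_code letters e \<le> m" for m
    using that
  proof (induction e arbitrary: m)
    case (EAut A)
    show ?case by (simp add: aut automaton_code_def code_nth_list_encode del: list_encode.simps)
  next
    case (EShuffle d e)
    show ?case
      by (rule step[OF _ expr_code_less(1) EShuffle(3,1)]) (simp_all add: leftmost_child_def)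
  next
    case (EIterated_Shuffle e)
    show ?case
      by (rule step[OF _ expr_code_less(3) EIterated_Shuffle(2,1)]) (simp_all add: leftmost_child_def)
  next
    case (EUnion d e)
    show ?case
      by (rule step[OF _ expr_code_less(4) EUnion(3,1)]) (simp_all add: leftmost_child_def)
  next
    case (EConc d e)
    show ?case
      by (rule step[OF _ expr_code_less(6) EConc(3,1)]) (simp_all add: leftmost_child_def)
  next
    case (EStar e)
    show ?case
      by (rule step[OF _ expr_code_less(8) EStar(2,1)]) (simp_all add: leftmost_child_def)
  qed
  then show ?thesis unfolding letter_number_def by blast
qed

text \<open>The automaton counts letters exactly below \<open>wrap_bound k x - fact x\<close> and modulo \<open>fact x\<close> from
  there on; its states are the weights of the count vectors, among junk numbers that are never reached.\<close>

definition wrap_bound :: "nat \<Rightarrow> nat \<Rightarrow> nat" where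
  "wrap_bound k x = Suc (gap_bound k x ^ Suc x) + fact x"

text \<open>Chosen so that \<open>k\<close> counts below \<open>wrap_bound k x\<close> add up to
  less than the base.\<close>

definition weight_base :: "nat \<Rightarrow> nat \<Rightarrow> nat" where
  "weight_base k x = Suc (k * wrap_bound k x)"

text \<open>When a count is at its maximum, adding one copy and removing \<open>fact x\<close>
  amounts to subtracting \<open>fact x - 1\<close> letter weights. The outer \<open>mod\<close>
  changes nothing on weights of bounded count vectors; it keeps the junk numbers inside the state
  set, so that the automaton is complete.\<close>

definition next_state :: "nat \<Rightarrow> nat \<Rightarrow> nat \<Rightarrow> nat \<Rightarrow> nat" where
  "next_state k x q i =
     (if Suc (q div weight_base k x ^ i mod weight_base k x) < wrap_bound k x
      then q + letter_weight k (weight_base k x) i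
      else q - (fact x - 1) * letter_weight k (weight_base k x) i) mod weight_base k x ^ Suc k"

definition final_state :: "nat \<Rightarrow> nat \<Rightarrow> nat \<Rightarrow> bool" where
  "final_state k x q \<longleftrightarrow> course_rec expr_step (prod_encode (k, weight_base k x)) (prod_encode (x, q))"

definition perm_automaton :: "'a list \<Rightarrow> nat \<Rightarrow> ('a, nat) automaton" where
  "perm_automaton letters x = \<lparr>
     alphabet = set letters,
     states = {..<weight_base (length letters) x ^ Suc (length letters)},
     transition = (\<lambda>q a. next_state (length letters) x q (inv_into {..<length letters} ((!) letters) a)),
     initial = 0,
     final = {q \<in> {..<weight_base (length letters) x ^ Suc (length letters)}. final_state (length letters) x q}\<rparr>"

text \<open>Letters are replaced by their positions, which leaves a function of numbers alone, to
  which \<open>computable\<close> applies.\<close>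

definition perm_automaton_code :: "nat \<Rightarrow> nat \<Rightarrow> nat" where
  "perm_automaton_code k x = list_encode
     [k,
      weight_base k x ^ Suc k,
      0,
      list_encode (map (\<lambda>q. of_bool (final_state k x q)) [0..<weight_base k x ^ Suc k]),
      list_encode (map (\<lambda>q. list_encode (map (\<lambda>i. next_state k x q i) [0..<k])) [0..<weight_base k x ^ Suc k])]"

section \<open>Computability of the code of the automaton\<close>

lemma computable_gap_bound [computable_intros]:
  "computable f \<Longrightarrow> computable g \<Longrightarrow> computable (\<lambda>x. gap_bound (f x) (g x))"
  unfolding gap_bound_def by (intro computable_intros)

lemma computable_wrap_bound [computable_intros]:
  "computable f \<Longrightarrow> computable g \<Longrightarrow> computable (\<lambda>x. wrap_bound (f x) (g x))"
  unfolding wrap_bound_def by (intro computable_intros)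

lemma computable_weight_base [computable_intros]:
  "computable f \<Longrightarrow> computable g \<Longrightarrow> computable (\<lambda>x. weight_base (f x) (g x))"
  unfolding weight_base_def by (intro computable_intros)

lemma computable_next_state [computable_intros]:
  "computable f \<Longrightarrow> computable g \<Longrightarrow> computable h \<Longrightarrow> computable h' \<Longrightarrow>
    computable (\<lambda>x. next_state (f x) (g x) (h x) (h' x))"
  unfolding next_state_def by (intro computable_intros)

lemma decidable_final_state [computable_intros]:
  "computable f \<Longrightarrow> computable g \<Longrightarrow> computable h \<Longrightarrow>
    decidable (\<lambda>x. final_state (f x) (g x) (h x))"
  unfolding final_state_def by (intro computable_intros)

lemma computable_letter_number [computable_intros]:
  "computable f \<Longrightarrow> computable (\<lambda>x. letter_number (f x))"
  unfolding letter_number_def leftmost_child_def by (intro computable_intros)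

lemma computable_perm_automaton_code:
  "computable (\<lambda>x. perm_automaton_code (letter_number x) x)"
  unfolding perm_automaton_code_def list_encode.simps by (intro computable_intros)

lemma automaton_code_perm_automaton:
  assumes "distinct letters"
  shows "automaton_code letters (perm_automaton letters x) = perm_automaton_code (length letters) x"
proof -
  have idx: "inv_into {..<length letters} ((!) letters) (letters ! i) = i" if "i < length letters" for i
    using assms that by (simp add: inv_into_f_f inj_on_nth)
  have "map (transition (perm_automaton letters x) q) letters =
      map (\<lambda>i. next_state (length letters) x q i) [0..<length letters]" for q
    by (rule nth_equalityI) (simp_all add: perm_automaton_def idx)
  moreover have "map (\<lambda>q. of_bool (q \<in> final (perm_automaton letters x)) :: nat) [0..<card (states (perm_automaton letters x))] =
      map (\<lambda>q. of_bool (final_state (length letters) x q)) [0..<weight_base (length letters) x ^ Suc (length letters)]"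
    by (intro map_cong) (simp_all add: perm_automaton_def del: power_Suc)
  ultimately show ?thesis
    unfolding automaton_code_def perm_automaton_code_def
    by (simp only:) (simp add: perm_automaton_def)
qed

section \<open>Correctness of the counting automaton\<close>

lemma perm_automaton_language:
  fixes letters :: "'a list"
  assumes letters: "distinct letters" and e: "expr_over (set letters) e"
  defines "x \<equiv> expr_code letters e"
  shows "automaton (perm_automaton letters x)"
    and "language (perm_automaton letters x) = perm_closure (set letters) (expr_language e)"
proof -
  let ?\<Sigma> = "set letters" and ?k = "length letters"
  let ?D = "weight_base ?k x" and ?M = "wrap_bound ?k x" and ?A = "perm_automaton letters x"
  let ?S = "mset ` expr_language e" and ?n = "fact x :: nat" and ?b = "gap_bound ?k x ^ Suc x"
  have D: "0 < ?D" by (simp add: weight_base_def)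
  have n: "0 < ?n" by simp
  show A: "automaton ?A"
    using D by (auto simp: automaton_def perm_automaton_def next_state_def)
  have S: "periodic ?\<Sigma> ?n ?b ?S"
    using periodic_expr_language[OF _ e, of letters x] distinct_card[OF letters] by (simp add: x_def)
  have M: "?M = Suc ?b + ?n" by (simp add: wrap_bound_def)
  have size: "size X < ?D" if "set_mset X \<subseteq> ?\<Sigma>" "\<And>a. count X a < ?M" for X :: "'a multiset"
  proof -
    have "(\<Sum>i<?k. count X (letters ! i)) \<le> (\<Sum>i<?k. ?M)"
      using that(2) by (intro sum_mono less_imp_le)
    then show ?thesis by (simp add: size_letters[OF letters that(1)] weight_base_def)
  qed
  have small: "weight letters ?D X < ?D ^ Suc ?k" if "set_mset X \<subseteq> ?\<Sigma>" "\<And>a. count X a < ?M" for X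
  proof -
    have "weight letters ?D X < Suc (size X) * ?D ^ ?k"
      using that by (intro weight_less letters size)
    also have "\<dots> \<le> ?D * ?D ^ ?k"
      using size[OF that] by (intro mult_le_mono1) simp
    finally show ?thesis by simp
  qed
  \<comment> \<open>The state represents a multiset \<open>X\<close> that is interchangeable with
    \<open>mset w\<close> in every context \<open>Y\<close>. Quantifying over contexts carries the
    induction: the next letter is first moved into \<open>Y\<close>.\<close>
  have run: "\<exists>X. set_mset X \<subseteq> ?\<Sigma> \<and> (\<forall>a. count X a < ?M) \<and>
      foldl (transition ?A) (initial ?A) w = weight letters ?D X \<and> (\<forall>Y. mset w + Y \<in> ?S \<longleftrightarrow> X + Y \<in> ?S)"
    if "w \<in> lists ?\<Sigma>" for w
    using that
  proof (induction w rule: rev_induct)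
    case Nil
    show ?case by (intro exI[of _ "{#}"]) (simp add: perm_automaton_def M)
  next
    case (snoc a w)
    then obtain X where X: "set_mset X \<subseteq> ?\<Sigma>" "\<And>a. count X a < ?M"
      "foldl (transition ?A) (initial ?A) w = weight letters ?D X" "\<And>Y. mset w + Y \<in> ?S \<longleftrightarrow> X + Y \<in> ?S"
      by auto
    obtain i where i: "i < ?k" "a = letters ! i" using snoc.prems by (auto simp: in_set_conv_nth)
    have a: "a \<in> ?\<Sigma>" using i by simp
    have "inv_into {..<?k} ((!) letters) a = i"
      using letters i by (simp add: inv_into_f_f inj_on_nth)
    then have next_X: "foldl (transition ?A) (initial ?A) (w @ [a]) = next_state ?k x (weight letters ?D X) i"
      using X(3) by (simp add: perm_automaton_def)
    have digit: "weight letters ?D X div ?D ^ i mod ?D = count X a"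
      using weight_digit[OF letters X(1) size[OF X(1,2)] i(1)] i(2) by simp
    show ?case
    proof (cases "Suc (count X a) < ?M")
      case True
      let ?X = "add_mset a X"
      have X': "set_mset ?X \<subseteq> ?\<Sigma>" "\<And>b. count ?X b < ?M" using X(1,2) a True by auto
      have "next_state ?k x (weight letters ?D X) i = weight letters ?D ?X"
        using small[OF X'] True weight_add_mset[OF letters i(1), of ?D X]
        unfolding next_state_def digit by (simp add: letter_weight_def i(2) add.commute)
      moreover have "mset (w @ [a]) + Y \<in> ?S \<longleftrightarrow> ?X + Y \<in> ?S" for Y
        using X(4)[of "add_mset a Y"] by simp
      ultimately show ?thesis using X' next_X by (intro exI[of _ ?X]) simp
    next
      case False
      \<comment> \<open>The maximal count is \<open>?b + ?n\<close>; after wrapping,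
        \<open>?b + 1\<close> copies remain, just enough for \<open>periodic_wrap\<close>.\<close>
      then have count: "count X a = ?b + ?n" using X(2)[of a] M by simp
      define X' where "X' = X - replicate_mset (?n - 1) a"
      have X_eq: "X = X' + replicate_mset (?n - 1) a"
        unfolding X'_def using count by (simp add: count_le_replicate_mset_subset_eq[symmetric])
      have X': "set_mset X' \<subseteq> ?\<Sigma>" "count X' b < ?M" for b
      proof -
        show "set_mset X' \<subseteq> ?\<Sigma>" using X(1) unfolding X'_def by (meson in_diffD subset_iff)
        show "count X' b < ?M" using X(2)[of b] unfolding X'_def by simp
      qed
      have "weight letters ?D X = weight letters ?D X' + (?n - 1) * letter_weight ?k ?D i"
        by (subst X_eq) (simp add: weight_replicate[OF letters i(1)] i(2) letter_weight_def)
      then have "next_state ?k x (weight letters ?D X) i = weight letters ?D X'"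
        using small[OF X'] False unfolding next_state_def digit by simp
      moreover have "mset (w @ [a]) + Y \<in> ?S \<longleftrightarrow> X' + Y \<in> ?S" for Y
      proof -
        have "?n = Suc (?n - 1)" using n by simp
        then have "replicate_mset ?n a = add_mset a (replicate_mset (?n - 1) a)"
          by (metis replicate_mset_Suc)
        then have shift: "X + add_mset a Y = (X' + Y) + replicate_mset ?n a"
          by (subst X_eq) simp
        have "count X a = count X' a + (?n - 1)" by (subst X_eq) simp
        then have "?b < count (X' + Y) a" using count n unfolding count_union by linarith
        from periodic_wrap[OF S a this] X(4)[of "add_mset a Y", unfolded shift]
        show ?thesis by simp
      qed
      ultimately show ?thesis using X' next_X by (intro exI[of _ X']) simp
    qed
  qed
  have "w \<in> language ?A \<longleftrightarrow> w \<in> lists ?\<Sigma> \<and> mset w \<in> ?S" for w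
  proof (cases "w \<in> lists ?\<Sigma>")
    case True
    obtain X where X: "set_mset X \<subseteq> ?\<Sigma>" "\<And>a. count X a < ?M"
      "foldl (transition ?A) (initial ?A) w = weight letters ?D X" "\<And>Y. mset w + Y \<in> ?S \<longleftrightarrow> X + Y \<in> ?S"
      using run[OF True] by blast
    have "w \<in> language ?A \<longleftrightarrow> final_state ?k x (weight letters ?D X)"
      using True X(3) small[OF X(1,2)] by (simp add: language_def perm_automaton_def)
    also have "\<dots> \<longleftrightarrow> weight letters ?D X \<in> weight letters ?D ` ?S"
      unfolding final_state_def x_def using expr_rec[OF letters _ e] D[unfolded x_def] by blast
    also have "\<dots> \<longleftrightarrow> X \<in> ?S"
      using weight_eqD[OF letters X(1) periodic_alphabet[OF S] size[OF X(1,2)]] by blast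
    also have "\<dots> \<longleftrightarrow> mset w \<in> ?S" using X(4)[of "{#}"] by simp
    finally show ?thesis using True by simp
  qed (simp add: language_def perm_automaton_def)
  moreover have "w \<in> perm_closure ?\<Sigma> (expr_language e) \<longleftrightarrow> w \<in> lists ?\<Sigma> \<and> mset w \<in> ?S" for w
  proof -
    have "(\<forall>a\<in>?\<Sigma>. count_list w a = count_list v a) \<longleftrightarrow> mset w = mset v"
      if "w \<in> lists ?\<Sigma>" "v \<in> expr_language e" for v
    proof -
      \<comment> \<open>\<open>perm_closure\<close> compares counts on the alphabet only; neither
        word has other letters, so the whole multisets agree.\<close>
      have "set v \<subseteq> ?\<Sigma>" using periodic_alphabet[OF S, of "mset v"] that(2) by simp
      then have "count_list w a = count_list v a" if "a \<notin> ?\<Sigma>" for a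
        using that \<open>w \<in> lists ?\<Sigma>\<close> by (metis count_notin in_listsD subsetD)
      then show ?thesis by (metis count_mset multiset_eq_iff)
    qed
    then show ?thesis unfolding perm_closure_def by auto
  qed
  ultimately show "language ?A = perm_closure ?\<Sigma> (expr_language e)" by blast
qed

theorem theorem11:
  "(\<forall>(\<Sigma> :: 'a set) L. finite \<Sigma> \<and> L \<in> SE {K. group_language \<Sigma> K} \<longrightarrow>
      regular_language \<Sigma> (perm_closure \<Sigma> L)) \<and>
   (\<exists>f. computable f \<and>
      (\<forall>(letters :: 'a list) e. distinct letters \<and> expr_over (set letters) e \<longrightarrow>
         (\<exists>B. automaton B \<and> standard_states B \<and> alphabet B = set letters \<and>
              f (expr_code letters e) = automaton_code letters B \<and>
              language B = perm_closure (set letters) (expr_language e))))"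
proof (intro conjI allI impI exI[of _ "\<lambda>x. perm_automaton_code (letter_number x) x"])
  fix \<Sigma> :: "'a set" and L
  assume asm: "finite \<Sigma> \<and> L \<in> SE {K. group_language \<Sigma> K}"
  then obtain letters where letters: "distinct letters" "set letters = \<Sigma>"
    using finite_distinct_list by blast
  obtain e where e: "expr_over \<Sigma> e" "expr_language e = L"
    using asm by (auto simp: SE_iff_expr)
  show "regular_language \<Sigma> (perm_closure \<Sigma> L)"
    unfolding regular_language_def
    using perm_automaton_language[OF letters(1), of e] e letters(2)
    by (intro exI[of _ "perm_automaton letters (expr_code letters e)"]) (simp add: perm_automaton_def)
next
  show "computable (\<lambda>x. perm_automaton_code (letter_number x) x)"
    by (rule computable_perm_automaton_code)
next
  fix letters :: "'a list" and e
  assume asm: "distinct letters \<and> expr_over (set letters) e"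
  let ?B = "perm_automaton letters (expr_code letters e)"
  have "standard_states ?B" "alphabet ?B = set letters"
    by (simp_all add: standard_states_def perm_automaton_def)
  then show "\<exists>B. automaton B \<and> standard_states B \<and> alphabet B = set letters \<and>
      perm_automaton_code (letter_number (expr_code letters e)) (expr_code letters e) = automaton_code letters B \<and>
      language B = perm_closure (set letters) (expr_language e)"
    using perm_automaton_language[of letters e] asm
    by (intro exI[of _ ?B]) (simp add: automaton_code_perm_automaton letter_number_expr_code)
qed

end
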